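(* Let $n,d\ge1$ be integers, let $B^n=\{\mathbf{x}\in\mathbb{R}^n:\|\mathbf{x}\|^2\le1\}$ be equipped with the probability measure $d\mu_B(\mathbf{x})=c_n(1-\|\mathbf{x}\|^2)^{-1/2}d\mathbf{x}$ (with $c_n>0$ a normalization constant), and let $f\in\mathbb{R}[\mathbf{x}]=\mathbb{R}[x_1,\dots,x_n]$ be a polynomial of degree $d$. Write $f_{\min}=\min_{\mathbf{x}\in B^n}f(\mathbf{x})$, $f_{\max}=\max_{\mathbf{x}\in B^n}f(\mathbf{x})$. Then for every integer $r\ge d$, the upper bound $\mathrm{ub}(f,\mathcal{T}(B^n))_r$ (with respect to $\mu_B$) satisfies $$\mathrm{ub}(f,\mathcal{T}(B^n))_r-f_{\min}\le\frac{C_B(n,d)}{2r^2}\,(f_{\max}-f_{\min}),\qquad\text{where } C_B(n,d)=2n^2d^3\,\gamma(B^n)_d .$$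
   Context: $\mathbb{R}[\mathbf{x}]_k$ denotes polynomials of degree at most $k$; $\Sigma[\mathbf{x}]$ denotes the set of sums of squares of polynomials in $\mathbb{R}[\mathbf{x}]$. Truncated preordering of the ball: $$\mathcal{T}(B^n)_{2r}=\{\sigma_0+\sigma_1\cdot(1-\|\mathbf{x}\|^2):\ \sigma_0,\sigma_1\in\Sigma[\mathbf{x}],\ \deg(\sigma_0)\le 2r,\ \deg(\sigma_1(1-\|\mathbf{x}\|^2))\le 2r\}.$$ Upper bound: $$\mathrm{ub}(f,\mathcal{T}(B^n))_r=\inf_{q\in\mathcal{T}(B^n)_{2r}}\Big\{\int_{B^n}f(\mathbf{x})q(\mathbf{x})\,d\mu_B(\mathbf{x}):\ \int_{B^n}q(\mathbf{x})\,d\mu_B(\mathbf{x})=1\Big\}.$$ The constant $\gamma(B^n)_d$: with the inner product $\langle p,q\rangle=\int_{B^n}pq\,d\mu_B$, let $H_k=\{p\in\mathbb{R}[\mathbf{x}]_k:\langle p,q\rangle=0\ \text{for all } q\in\mathbb{R}[\mathbf{x}]_{k-1}\}$ (with $H_0$ the constants). Every $p\in\mathbb{R}[\mathbf{x}]_d$ decomposes uniquely as $p=\sum_{k=0}^d p_k$ with $p_k\in H_k$. With $\|p\|_{B^n}=\max_{\mathbf{x}\in B^n}|p(\mathbf{x})|$, set $$\gamma(B^n)_d=\max_{0\ne p\in\mathbb{R}[\mathbf{x}]_d}\ \max_{0\le k\le d}\frac{\|p_k\|_{B^n}}{\|p\|_{B^n}}<\infty .$$ *)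

theory Defs
  imports "HOL-Analysis.Analysis" "HOL-Library.Poly_Mapping"
begin

text \<open>
  Real polynomials in finitely many variables indexed by the type \<open>'n\<close>: finitely supported
  functions from exponent vectors to coefficients. Addition and (convolution) multiplication
  are those of \<open>Poly_Mapping\<close>.
\<close>

type_synonym 'n rpoly = "('n \<Rightarrow>\<^sub>0 nat) \<Rightarrow>\<^sub>0 real"

definition eval :: "'n::finite rpoly \<Rightarrow> real ^ 'n \<Rightarrow> real" where
  "eval p x = (\<Sum>m\<in>Poly_Mapping.keys p.
     Poly_Mapping.lookup p m * (\<Prod>i\<in>UNIV. (x $ i) ^ Poly_Mapping.lookup m i))"

text \<open>The zero polynomial gets total degree \<open>0\<close>, like the nonzero constants.\<close>

definition tdeg :: "'n::finite rpoly \<Rightarrow> nat" where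
  "tdeg p = Max (insert 0 ((\<lambda>m. \<Sum>i\<in>UNIV. Poly_Mapping.lookup m i) ` Poly_Mapping.keys p))"

definition var :: "'n \<Rightarrow> 'n rpoly" where
  "var i = Poly_Mapping.single (Poly_Mapping.single i 1) 1"

definition sos :: "'n rpoly set" where
  "sos = {p. \<exists>(N::nat) g. p = (\<Sum>j<N. (g j)\<^sup>2)}"

text \<open>The polynomial \<open>1 - x\<^sub>1\<^sup>2 - \<dots> - x\<^sub>n\<^sup>2\<close>.\<close>

definition ball_poly :: "'n::finite rpoly" where
  "ball_poly = 1 - (\<Sum>i\<in>UNIV. (var i)\<^sup>2)"

definition ball_preordering :: "nat \<Rightarrow> 'n::finite rpoly set" where
  "ball_preordering k = {s0 + s1 * ball_poly | s0 s1.
     s0 \<in> sos \<and> s1 \<in> sos \<and> tdeg s0 \<le> k \<and> tdeg (s1 * ball_poly) \<le> k}"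

abbreviation unit_ball :: "(real ^ 'n::finite) set" where
  "unit_ball \<equiv> cball 0 1"

definition ball_const :: "'n::finite itself \<Rightarrow> real" where
  "ball_const _ =
     1 / (LINT x:unit_ball|lborel. (1 - (norm (x :: real ^ 'n))\<^sup>2) powr (- 1 / 2))"

text \<open>
  The measure lives on the whole space and vanishes outside the closed unit ball, so integrals
  over the ball are written as plain integrals. On the unit sphere, a null set, the weight is
  \<open>0 powr (- 1 / 2) = 0\<close>.
\<close>

definition ball_measure :: "(real ^ 'n::finite) measure" where
  "ball_measure = density lborel
     (\<lambda>x. ennreal (indicator unit_ball x *
        (ball_const TYPE('n) * (1 - (norm x)\<^sup>2) powr (- 1 / 2))))"

definition ub :: "'n::finite rpoly \<Rightarrow> nat \<Rightarrow> real" where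
  "ub f r = Inf {LINT x|ball_measure. eval f x * eval q x | q.
     q \<in> ball_preordering (2 * r) \<and> (LINT x|ball_measure. eval q x) = 1}"

definition ball_inner :: "'n::finite rpoly \<Rightarrow> 'n rpoly \<Rightarrow> real" where
  "ball_inner p q = (LINT x|ball_measure. eval p x * eval q x)"

text \<open>
  For \<open>k = 0\<close> the orthogonality condition is void and \<open>orth_space 0\<close> consists of the constants.
\<close>

definition orth_space :: "nat \<Rightarrow> 'n::finite rpoly set" where
  "orth_space k = {p. tdeg p \<le> k \<and> (\<forall>q. tdeg q < k \<longrightarrow> ball_inner p q = 0)}"

definition ball_min :: "'n::finite rpoly \<Rightarrow> real" where
  "ball_min p = (INF x\<in>unit_ball. eval p x)"

definition ball_max :: "'n::finite rpoly \<Rightarrow> real" where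
  "ball_max p = (SUP x\<in>unit_ball. eval p x)"

definition ball_norm :: "'n::finite rpoly \<Rightarrow> real" where
  "ball_norm p = (SUP x\<in>unit_ball. \<bar>eval p x\<bar>)"

text \<open>
  Since the decomposition \<open>p = (\<Sum>k\<le>d. c k)\<close> with \<open>c k \<in> orth_space k\<close> exists and is unique,
  ranging over all decompositions amounts to ranging over the \<open>p\<close> of degree at most \<open>d\<close>. The
  supremum is a maximum, as are \<open>ball_max\<close> and \<open>ball_norm\<close> (and \<open>ball_min\<close> a minimum), by
  compactness.
\<close>

definition ball_gamma :: "'n::finite itself \<Rightarrow> nat \<Rightarrow> real" where
  "ball_gamma _ d = Sup {ball_norm (c k) / ball_norm p | (p :: 'n rpoly) c k.
     p \<noteq> 0 \<and> tdeg p \<le> d \<and> (\<forall>j\<le>d. c j \<in> orth_space j) \<and> p = (\<Sum>j\<le>d. c j) \<and> k \<le> d}"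

definition C_B :: "'n::finite itself \<Rightarrow> nat \<Rightarrow> real" where
  "C_B _ d = 2 * (real CARD('n))\<^sup>2 * real d ^ 3 * ball_gamma TYPE('n) d"

end

theory Submission
  imports Defs "HOL-Computational_Algebra.Polynomial"
begin

text \<open>
  The measure \<open>\<mu>\<^sub>B\<close> is the projection of the uniform measure on the unit sphere of \<open>\<real>\<^sup>n \<times> \<real>\<close>. Let
  \<open>u\<close> be a point of the sphere above a minimizer of \<open>f\<close>. On great circles through \<open>u\<close> the polynomial
  \<open>f\<close> is a trigonometric polynomial of degree \<open>d\<close> with a minimum at \<open>u\<close>; Parseval's identity
  bounds its second derivative and yields
  \<open>f(z) - f\<^sub>m\<^sub>i\<^sub>n \<le> d\<^sup>3 (f\<^sub>m\<^sub>a\<^sub>x - f\<^sub>m\<^sub>i\<^sub>n) (1 - z \<bullet> u) / 2\<close> on the whole sphere. Hence it suffices to find a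
  univariate \<open>p\<close> of degree at most \<open>r\<close> such that \<open>q = p(z \<bullet> u)\<^sup>2\<close> has mean \<open>1\<close> and \<open>(1 - z \<bullet> u) q\<close>
  has mean at most \<open>2 n\<^sup>2 / r\<^sup>2\<close>; the average of \<open>q\<close> over the two hemispheres is in \<open>\<T>(B\<^sup>n)\<^sub>2\<^sub>r\<close>.
  For a combination \<open>p\<close> of ultraspherical polynomials these two means are the norm and the Dirichlet
  form of a birth-death chain, and linearly decreasing coefficients suffice. The constant
  \<open>\<gamma>(B\<^sup>n)\<^sub>d\<close> enters only through \<open>\<gamma>(B\<^sup>n)\<^sub>d \<ge> 1\<close>. The supremum that defines it is over a bounded set,
  because the growth estimate, applied at a point where a polynomial attains its sup norm, bounds the
  sup norm by the \<open>L\<^sup>2\<close> norm.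
\<close>

section \<open>Ultraspherical polynomials\<close>

text \<open>The orthogonal polynomials of the weight \<open>(1 - t\<^sup>2)\<^bsup>(n - 2) / 2\<^esup>\<close> on \<open>[-1, 1]\<close>,
  normalized to have the value \<open>1\<close> at \<open>1\<close>.\<close>

fun ultra :: "nat \<Rightarrow> nat \<Rightarrow> real poly" where
  "ultra n 0 = 1"
| "ultra n (Suc 0) = [:0, 1:]"
| "ultra n (Suc (Suc k)) = smult (1 / real (k + n))
     (smult (real (2 * k + n + 1)) ([:0, 1:] * ultra n (Suc k)) - smult (real (k + 1)) (ultra n k))"

section \<open>Recurrence and derivative formula of the ultraspherical polynomials\<close>

lemma degree_ultra: "degree (ultra n k) \<le> k"
proof (induction n k rule: ultra.induct)
  case (3 n k)
  have "degree ([:0, 1:] * ultra n (Suc k)) \<le> Suc (Suc k)"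
    using degree_mult_le[of "[:0, 1:]" "ultra n (Suc k)"] 3 by simp
  then show ?case
    using 3 unfolding ultra.simps
    by (intro order.trans[OF degree_smult_le] degree_diff_le) (auto intro: order.trans[OF degree_smult_le])
qed auto

text \<open>For \<open>n \<ge> 1\<close> the divisor \<open>k + n\<close> is nonzero, so the
  quotient in the definition can be cleared. Later proofs use the recurrence only in this
  form.\<close>

lemma ultra_rec:
  assumes "n \<ge> 1"
  shows "smult (real (2 * k + n + 1)) ([:0, 1:] * ultra n (Suc k)) =
    smult (real (k + n)) (ultra n (Suc (Suc k))) + smult (real (k + 1)) (ultra n k)"
  using assms by simp

declare ultra.simps(3) [simp del]

lemma ultra_rec_poly:
  assumes "n \<ge> 1"
  shows "(k + n) * poly (ultra n (Suc (Suc k))) x =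
    (2 * k + n + 1) * x * poly (ultra n (Suc k)) x - (k + 1) * poly (ultra n k) x"
  using arg_cong[OF ultra_rec[OF assms, of k], of "\<lambda>p. poly p x"] by (simp add: algebra_simps)

text \<open>Strong induction: differentiating the recurrence expresses the new derivative through
  the two preceding ones, and the induction hypothesis turns those into values.\<close>

lemma pderiv_ultra_poly:
  assumes "n \<ge> 1"
  shows "(1 - x\<^sup>2) * poly (pderiv (ultra n (Suc k))) x =
    (k + 1) * (poly (ultra n k) x - x * poly (ultra n (Suc k)) x)"
proof (induction k rule: less_induct)
  case (less k)
  show ?case
  proof (cases k)
    case 0
    then show ?thesis by (simp add: pderiv_pCons power2_eq_square)
  next
    case (Suc j)
    let ?p = "\<lambda>i. poly (ultra n i) x" and ?d = "\<lambda>i. poly (pderiv (ultra n i)) x"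
    \<comment> \<open>The companion relation that raises the index: the induction hypothesis for
      \<open>j - 1\<close>, with the polynomial of index \<open>j - 1\<close> eliminated by the
      recurrence.\<close>
    have lower: "(1 - x\<^sup>2) * ?d j = (j + real n - 1) * (x * ?p j - ?p (Suc j))"
    proof (cases j)
      case (Suc i)
      then show ?thesis
        using less.IH[of i] \<open>k = Suc j\<close> ultra_rec_poly[OF assms, of i x] by (simp add: algebra_simps)
    qed simp
    have step: "(1 - x\<^sup>2) * ?d (Suc j) = (j + 1) * (?p j - x * ?p (Suc j))"
      using less.IH[of j] Suc by simp
    have "(j + n) * ?d (Suc (Suc j)) =
        (2 * j + n + 1) * (?p (Suc j) + x * ?d (Suc j)) - (j + 1) * ?d j"
      using arg_cong[OF ultra_rec[OF assms, of j], of "\<lambda>p. poly (pderiv p) x"]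
      by (simp add: pderiv_smult pderiv_add pderiv_mult pderiv_pCons algebra_simps)
    then have "(j + n) * ((1 - x\<^sup>2) * ?d (Suc (Suc j))) =
        (2 * j + n + 1) * ((1 - x\<^sup>2) * ?p (Suc j) + x * ((1 - x\<^sup>2) * ?d (Suc j)))
        - (j + 1) * ((1 - x\<^sup>2) * ?d j)"
      by algebra
    also have "\<dots> = (j + 2) * ((j + n) * ?p (Suc j) - x * ((j + n) * ?p (Suc (Suc j))))"
      unfolding lower step using ultra_rec_poly[OF assms, of j x]
      by (simp only: of_nat_add of_nat_mult of_nat_1 of_nat_numeral)
        (simp add: algebra_simps power2_eq_square)
    finally have "(j + n) * ((1 - x\<^sup>2) * ?d (Suc (Suc j))) =
        (j + n) * ((j + 2) * (?p (Suc j) - x * ?p (Suc (Suc j))))"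
      by (simp add: algebra_simps)
    then have "(1 - x\<^sup>2) * ?d (Suc (Suc j)) = (j + 2) * (?p (Suc j) - x * ?p (Suc (Suc j)))"
      using assms by simp
    then show ?thesis using Suc by simp
  qed
qed

lemma pderiv_ultra:
  assumes "n \<ge> 1"
  shows "[:1, 0, -1:] * pderiv (ultra n (Suc k)) =
    smult (k + 1) (ultra n k - [:0, 1:] * ultra n (Suc k))"
proof -
  have "poly ([:1, 0, -1:] * pderiv (ultra n (Suc k))) x =
      poly (smult (k + 1) (ultra n k - [:0, 1:] * ultra n (Suc k))) x" for x
    using pderiv_ultra_poly[OF assms, of x k] by (simp add: power2_eq_square algebra_simps)
  then show ?thesis by (simp add: poly_eq_poly_eq_iff[symmetric] fun_eq_iff)
qed

text \<open>The dimensions of the homogeneous polynomials of degree \<open>k\<close> in \<open>n\<close> variables, and of the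
  harmonic ones in \<open>n + 1\<close> variables. The squared norm of \<open>ultra n k\<close> is \<open>1 / sdim n k\<close>.\<close>

definition hdim :: "nat \<Rightarrow> nat \<Rightarrow> real" where
  "hdim n k = real ((k + n - 1) choose k)"

definition sdim :: "nat \<Rightarrow> nat \<Rightarrow> real" where
  "sdim n k = hdim n k + (if k = 0 then 0 else hdim n (k - 1))"

lemma hdim_Suc:
  assumes "n \<ge> 1"
  shows "(k + 1) * hdim n (Suc k) = (k + n) * hdim n k"
proof -
  obtain m where m: "n = Suc m" using assms by (cases n) auto
  have "Suc k * (Suc (k + m) choose Suc k) = Suc (k + m) * ((k + m) choose k)"
    by (rule Suc_times_binomial)
  then have "real (Suc k * (Suc (k + m) choose Suc k)) = real (Suc (k + m) * ((k + m) choose k))"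
    by (rule arg_cong)
  then show ?thesis by (simp add: hdim_def m algebra_simps)
qed

lemma hdim_0 [simp]: "hdim n 0 = 1"
  by (simp add: hdim_def)

lemma hdim_pos: "n \<ge> 1 \<Longrightarrow> hdim n k > 0"
  by (simp add: hdim_def)

lemma sdim_pos: "n \<ge> 1 \<Longrightarrow> sdim n k > 0"
  by (simp add: sdim_def add_pos_pos hdim_pos)

text \<open>The coefficients \<open>(k + n) / (2 * k + n + 1)\<close> and
  \<open>(k + 1) / (2 * k + n + 1)\<close> in the expansion of X times
  \<open>ultra n (Suc k)\<close> are thereby quotients of \<open>hdim\<close> by
  \<open>sdim\<close>: the up and down probabilities of a birth-death chain with edge weights
  \<open>hdim\<close> and vertex weights \<open>sdim\<close>.\<close>

lemma sdim_hdim: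
  assumes "n \<ge> 1"
  shows "(k + n) * sdim n (Suc k) = (2 * k + n + 1) * hdim n (Suc k)"
    and "(k + 1) * sdim n (Suc k) = (2 * k + n + 1) * hdim n k"
  using hdim_Suc[OF assms, of k] by (auto simp: sdim_def algebra_simps)

text \<open>The integration by parts rule \<open>l_parts\<close> and \<open>l_1\<close> determine all moments of \<open>l\<close>,
  so the test polynomial below can be chosen independently of \<open>l\<close>.\<close>

locale ultra_functional =
  fixes n :: nat and l :: "real poly \<Rightarrow> real"
  assumes n: "n \<ge> 1"
    and l_add: "l (p + q) = l p + l q"
    and l_smult: "l (smult c p) = c * l p"
    and l_1: "l 1 = 1"
    and l_parts: "l ([:1, 0, -1:] * pderiv g) = n * l ([:0, 1:] * g)"
begin

section \<open>Orthogonality and norms, derived from integration by parts\<close>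

lemma l_0: "l 0 = 0"
  using l_smult[of 0 0] by simp

lemma l_minus: "l (- p) = - l p"
  using l_smult[of "-1" p] by simp

lemma l_diff: "l (p - q) = l p - l q"
  using l_add[of p "- q"] by (simp add: l_minus)

lemma l_sum: "l (\<Sum>i\<in>A. f i) = (\<Sum>i\<in>A. l (f i))"
  by (induction A rule: infinite_finite_induct) (auto simp: l_0 l_add)

text \<open>Integration by parts and the recurrence give two relations between the means of indices
  \<open>j\<close> and \<open>j + 2\<close> and the mean of X times the polynomial of index
  \<open>j + 1\<close>. Eliminating the last two quantities leaves only the mean of index
  \<open>j + 2\<close>.\<close>

lemma l_ultra: "l (ultra n (Suc k)) = 0"
proof (induction k rule: less_induct)
  case (less k)
  show ?case
  proof (cases k)
    case 0
    have "l ([:1, 0, -1:] * pderiv 1) = n * l [:0, 1:]"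
      using l_parts[of 1] by simp
    then show ?thesis using 0 n by (simp add: l_0)
  next
    case (Suc j)
    let ?t = "l ([:0, 1:] * ultra n (Suc j))"
    have 1: "(j + 1) * l (ultra n j) = (j + 1 + n) * ?t"
      using l_parts[of "ultra n (Suc j)"] unfolding pderiv_ultra[OF n] l_smult l_diff
      by (simp add: algebra_simps)
    have 2: "(2 * j + n + 1) * ?t = (j + n) * l (ultra n (Suc (Suc j))) + (j + 1) * l (ultra n j)"
      using arg_cong[OF ultra_rec[OF n, of j], of l] unfolding l_add l_smult by simp
    \<comment> \<open>For \<open>j = 0\<close> the mean of \<open>ultra n 0\<close> is 1 and the
      induction hypothesis says nothing; the factor \<open>j\<close> covers this case.\<close>
    have "j * ?t = 0"
    proof (cases j)
      case (Suc i)
      then have "l (ultra n j) = 0" using less[of i] \<open>k = Suc j\<close> by simp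
      then have "(j + 1 + n) * ?t = 0" using 1 by simp
      then show ?thesis by simp
    qed simp
    moreover have "(2 * j + n + 1) * ?t = j * ?t + (j + 1 + n) * ?t"
      by (simp add: algebra_simps)
    ultimately have "(j + n) * l (ultra n (Suc (Suc j))) = 0"
      using 1 2 by linarith
    then show ?thesis using Suc n by simp
  qed
qed

lemma l_rec_mult:
  "(2 * k + n + 1) * l ([:0, 1:] * ultra n (Suc k) * q) =
    (k + n) * l (ultra n (Suc (Suc k)) * q) + (k + 1) * l (ultra n k * q)"
proof -
  have "l (smult (real (2 * k + n + 1)) ([:0, 1:] * ultra n (Suc k)) * q) =
      l ((smult (real (k + n)) (ultra n (Suc (Suc k))) + smult (real (k + 1)) (ultra n k)) * q)"
    by (simp only: ultra_rec[OF n])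
  then show ?thesis
    by (simp only: distrib_right mult_smult_left l_add l_smult of_nat_add of_nat_mult)
qed

text \<open>Multiplication by X is symmetric for the form \<open>l (p * q)\<close>, so the factor X
  can be moved from the polynomial of small index to that of large index. The induction starts from
  the vanishing means.\<close>

lemma ultra_orthogonal: "j < k \<Longrightarrow> l (ultra n j * ultra n k) = 0"
proof (induction j arbitrary: k rule: less_induct)
  case (less j)
  then obtain k' where k: "k = Suc k'" by (cases k) auto
  show ?case
  proof (cases j)
    case 0
    then show ?thesis using l_ultra k by simp
  next
    case (Suc j')
    \<comment> \<open>X times \<open>ultra n k\<close> involves only the indices
      \<open>k + 1\<close> and \<open>k - 1\<close>, and both exceed \<open>j'\<close>.\<close>
    have *: "l ([:0, 1:] * ultra n k * ultra n j') = 0"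
    proof -
      have "l (ultra n (Suc k) * ultra n j') = 0"
        using less.IH[of j' "Suc k"] less.prems Suc by (simp add: mult.commute)
      moreover have "l (ultra n k' * ultra n j') = 0"
        using less.IH[of j' "k'"] less.prems Suc k by (simp add: mult.commute)
      ultimately have "(2 * k' + n + 1) * l ([:0, 1:] * ultra n k * ultra n j') = 0"
        using l_rec_mult[of k' "ultra n j'"] k by simp
      moreover have "real (2 * k' + n + 1) \<noteq> 0" by (simp only: of_nat_eq_0_iff)
      ultimately show ?thesis by simp
    qed
    show ?thesis
    proof (cases j')
      case 0
      then show ?thesis using * Suc by (simp add: mult.commute)
    next
      case (Suc i)
      have "l (ultra n i * ultra n k) = 0"
        using less.IH[of i k] less.prems \<open>j = Suc j'\<close> Suc by simp
      moreover have "l ([:0, 1:] * ultra n (Suc i) * ultra n k) = 0"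
        using * Suc by (simp add: mult_ac)
      ultimately have "(i + n) * l (ultra n (Suc (Suc i)) * ultra n k) = 0"
        using l_rec_mult[of i "ultra n k"] by simp
      then show ?thesis using n \<open>j = Suc j'\<close> Suc by simp
    qed
  qed
qed

lemma ultra_orthogonal': "j \<noteq> k \<Longrightarrow> l (ultra n j * ultra n k) = 0"
  using ultra_orthogonal[of j k] ultra_orthogonal[of k j] by (auto simp: mult.commute neq_iff)

text \<open>Expand X times \<open>ultra n k\<close> by the recurrence; the part of index
  \<open>k - 1\<close> is orthogonal to \<open>ultra n (Suc k)\<close>.\<close>

lemma l_X_ultra:
  "l ([:0, 1:] * ultra n k * ultra n (Suc k)) * sdim n k = hdim n k * l (ultra n (Suc k) * ultra n (Suc k))"
proof (cases k)
  case (Suc j)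
  have "(2 * j + n + 1) * l ([:0, 1:] * ultra n k * ultra n (Suc k)) =
      (j + n) * l (ultra n (Suc k) * ultra n (Suc k))"
    using l_rec_mult[of j "ultra n (Suc k)"] Suc by (simp add: ultra_orthogonal)
  then have "(2 * j + n + 1) * (l ([:0, 1:] * ultra n k * ultra n (Suc k)) * sdim n k) =
      ((j + n) * sdim n (Suc j)) * l (ultra n (Suc k) * ultra n (Suc k))"
    using Suc by (simp only: mult_ac)
  also have "real (j + n) * sdim n (Suc j) = real (2 * j + n + 1) * hdim n k"
    using sdim_hdim(1)[OF n, of j] Suc by simp
  finally have "real (2 * j + n + 1) * (l ([:0, 1:] * ultra n k * ultra n (Suc k)) * sdim n k) =
    real (2 * j + n + 1) * (hdim n k * l (ultra n (Suc k) * ultra n (Suc k)))"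
    by (simp only: mult.assoc)
  then show ?thesis
    by (simp only: mult_cancel_left of_nat_eq_0_iff) auto
qed (simp add: sdim_def)

text \<open>The mean of X times two consecutive polynomials is evaluated twice, with X expanded on
  either factor. This determines the ratio of consecutive squared norms.\<close>

lemma l_ultra_square: "l (ultra n k * ultra n k) * sdim n k = 1"
proof (induction k)
  case 0
  then show ?case by (simp add: l_1 sdim_def)
next
  case (Suc k)
  let ?c = "real (2 * k + n + 1)"
  have "?c * l ([:0, 1:] * ultra n (Suc k) * ultra n k) = (k + 1) * l (ultra n k * ultra n k)"
    using l_rec_mult[of k "ultra n k"] ultra_orthogonal[of k "Suc (Suc k)"]
    by (simp add: mult.commute)
  then have "?c * (l ([:0, 1:] * ultra n k * ultra n (Suc k)) * sdim n k) = k + 1"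
    using Suc by (simp add: mult_ac)
  then have "(?c * hdim n k) * l (ultra n (Suc k) * ultra n (Suc k)) = k + 1"
    unfolding l_X_ultra by (simp only: mult_ac)
  then have "(k + 1) * (l (ultra n (Suc k) * ultra n (Suc k)) * sdim n (Suc k)) = k + 1"
    using arg_cong[OF sdim_hdim(2)[OF n, of k], of "\<lambda>x. x * l (ultra n (Suc k) * ultra n (Suc k))"]
    by (simp add: algebra_simps)
  moreover have "real (k + 1) * x = real (k + 1) \<Longrightarrow> x = 1" for x :: real
    by auto
  ultimately show ?case by blast
qed

lemma l_X_ultra': "l ([:0, 1:] * ultra n k * ultra n (Suc k)) * sdim n k * sdim n (Suc k) = hdim n k"
  unfolding l_X_ultra using l_ultra_square[of "Suc k"] by (simp only: mult.assoc mult_1_right)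

lemma l_X_ultra_eq_0:
  assumes "j \<noteq> Suc k" "k \<noteq> Suc j"
  shows "l ([:0, 1:] * ultra n j * ultra n k) = 0"
proof (cases j)
  case 0
  then show ?thesis using assms ultra_orthogonal'[of 1 k] by (cases k) (auto simp: l_ultra)
next
  case (Suc i)
  have "l (ultra n (Suc (Suc i)) * ultra n k) = 0" "l (ultra n i * ultra n k) = 0"
    using assms Suc by (auto intro!: ultra_orthogonal')
  then have "(2 * i + n + 1) * l ([:0, 1:] * ultra n j * ultra n k) = 0"
    using l_rec_mult[of i "ultra n k"] Suc by simp
  moreover have "real (2 * i + n + 1) \<noteq> 0" by (simp only: of_nat_eq_0_iff)
  ultimately show ?thesis by simp
qed


section \<open>The norm and the Dirichlet form of a test polynomial\<close>

lemma l_test_square: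
  "l ((\<Sum>k\<le>r. smult (c k * sdim n k) (ultra n k))\<^sup>2) = (\<Sum>k\<le>r. (c k)\<^sup>2 * sdim n k)"
proof -
  have "l ((\<Sum>k\<le>r. smult (c k * sdim n k) (ultra n k))\<^sup>2) =
      (\<Sum>j\<le>r. \<Sum>k\<le>r. c k * sdim n k * (c j * sdim n j * l (ultra n j * ultra n k)))"
    by (simp only: power2_eq_square sum_product l_sum mult_smult_left mult_smult_right l_smult)
  also have "\<dots> = (\<Sum>j\<le>r. \<Sum>k\<le>r. if k = j then c j * c j * sdim n j else 0)"
  proof (intro sum.cong refl)
    fix j k
    show "c k * sdim n k * (c j * sdim n j * l (ultra n j * ultra n k)) =
        (if k = j then c j * c j * sdim n j else 0)"
      using ultra_orthogonal'[of j k] l_ultra_square[of j]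
      by (auto simp: mult_ac)
  qed
  also have "\<dots> = (\<Sum>k\<le>r. (c k)\<^sup>2 * sdim n k)"
    by (simp add: power2_eq_square)
  finally show ?thesis .
qed

text \<open>In the ultraspherical basis multiplication by X is tridiagonal with zero diagonal, so
  appending the term of index \<open>r + 1\<close> contributes only its cross term with index
  \<open>r\<close>.\<close>

lemma l_test_X:
  "l ([:0, 1:] * (\<Sum>k\<le>r. smult (c k * sdim n k) (ultra n k))\<^sup>2) =
    (\<Sum>k<r. 2 * c k * c (Suc k) * hdim n k)"
proof -
  let ?q = "\<lambda>k. smult (c k * sdim n k) (ultra n k)"
  have Xq: "l ([:0, 1:] * (?q j * ?q k)) =
      c j * c k * (l ([:0, 1:] * ultra n j * ultra n k) * sdim n j * sdim n k)" for j k
    by (simp only: mult_smult_left mult_smult_right l_smult mult_ac)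
  have off: "l ([:0, 1:] * (?q j * ?q (Suc j))) = c j * c (Suc j) * hdim n j" for j
    unfolding Xq l_X_ultra' ..
  have zero: "l ([:0, 1:] * (?q j * ?q k)) = 0" if "j \<noteq> Suc k" "k \<noteq> Suc j" for j k
    unfolding Xq l_X_ultra_eq_0[OF that] by simp
  show ?thesis
  proof (induction r)
    case 0
    then show ?case using zero[of 0 0] by (simp add: power2_eq_square)
  next
    case (Suc r)
    let ?S = "\<Sum>k\<le>r. ?q k"
    have "l ([:0, 1:] * (?S * ?q (Suc r))) = (\<Sum>k\<le>r. l ([:0, 1:] * (?q k * ?q (Suc r))))"
      by (simp only: sum_distrib_right sum_distrib_left l_sum)
    also have "\<dots> = (\<Sum>k\<le>r. if k = r then c r * c (Suc r) * hdim n r else 0)"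
    proof (intro sum.cong refl)
      fix k assume "k \<in> {..r}"
      then show "l ([:0, 1:] * (?q k * ?q (Suc r))) = (if k = r then c r * c (Suc r) * hdim n r else 0)"
        using off[of r] zero[of k "Suc r"] by (cases "k = r") auto
    qed
    finally have cross: "l ([:0, 1:] * (?S * ?q (Suc r))) = c r * c (Suc r) * hdim n r"
      by simp
    have "(\<Sum>k\<le>Suc r. ?q k)\<^sup>2 = ?S\<^sup>2 + (?S * ?q (Suc r) + ?S * ?q (Suc r)) + ?q (Suc r) * ?q (Suc r)"
      by (simp only: sum.atMost_Suc) (simp only: power2_eq_square distrib_left distrib_right add_ac mult_ac)
    then show ?case
      using Suc zero[of "Suc r" "Suc r"] cross
      by (simp only: distrib_left l_add) simp
  qed
qed

text \<open>Each vertex weight \<open>sdim\<close> is the sum of the weights of the two adjacent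
  edges, so the squares distribute over the edges and complete the cross terms to squared
  differences. The condition at \<open>Suc r\<close> turns the leftover term at \<open>r\<close>
  into such a difference.\<close>

lemma l_test_one_minus_X:
  assumes "c (Suc r) = 0"
  shows "l ([:1, -1:] * (\<Sum>k\<le>r. smult (c k * sdim n k) (ultra n k))\<^sup>2) =
    (\<Sum>k\<le>r. (c k - c (Suc k))\<^sup>2 * hdim n k)"
proof -
  let ?p = "\<Sum>k\<le>r. smult (c k * sdim n k) (ultra n k)"
  have "[:1, -1:] * ?p\<^sup>2 = ?p\<^sup>2 - [:0, 1:] * ?p\<^sup>2"
    by simp
  then have "l ([:1, -1:] * ?p\<^sup>2) = (\<Sum>k\<le>r. (c k)\<^sup>2 * sdim n k) - (\<Sum>k<r. 2 * c k * c (Suc k) * hdim n k)"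
    by (simp only: l_diff l_test_square l_test_X)
  also have "(\<Sum>k\<le>r. (c k)\<^sup>2 * sdim n k) = (\<Sum>k\<le>r. (c k)\<^sup>2 * hdim n k) + (\<Sum>k<r. (c (Suc k))\<^sup>2 * hdim n k)"
    by (induction r) (auto simp: sdim_def algebra_simps)
  also have "\<dots> - (\<Sum>k<r. 2 * c k * c (Suc k) * hdim n k) =
      (\<Sum>k<r. (c k - c (Suc k))\<^sup>2 * hdim n k) + (c r)\<^sup>2 * hdim n r"
    by (induction r) (auto simp: algebra_simps power2_eq_square)
  also have "\<dots> = (\<Sum>k\<le>r. (c k - c (Suc k))\<^sup>2 * hdim n k)"
    using assms by (simp add: lessThan_Suc_atMost[symmetric])
  finally show ?thesis .
qed

end

section \<open>Sums of dimensions and the linearly decreasing coefficients\<close>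

lemma sum_hdim:
  assumes "n \<ge> 1"
  shows "n * (\<Sum>k\<le>r. hdim n k) = (r + n) * hdim n r"
proof (induction r)
  case (Suc r)
  have "n * (\<Sum>k\<le>Suc r. hdim n k) = (r + n) * hdim n r + n * hdim n (Suc r)"
    using Suc by (simp add: algebra_simps)
  then show ?case using hdim_Suc[OF assms, of r] by (simp add: algebra_simps)
qed simp

text \<open>Passing from \<open>r\<close> to \<open>r + 1\<close> raises every weight by 1, so the
  increment is the unweighted sum; this is a second hockey-stick summation.\<close>

lemma sum_hdim_linear:
  assumes "n \<ge> 1"
  shows "(n + 1) * (\<Sum>k\<le>r. (real r + 1 - k) * hdim n k) = (r + n + 1) * (\<Sum>k\<le>r. hdim n k)"
proof (induction r)
  case (Suc r)
  have "(\<Sum>k\<le>Suc r. (real (Suc r) + 1 - k) * hdim n k) =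
      (\<Sum>k\<le>r. (real r + 1 - k) * hdim n k) + (\<Sum>k\<le>Suc r. hdim n k)"
    by (simp add: sum.distrib[symmetric] algebra_simps)
  then show ?case
    using Suc sum_hdim[OF assms, of "Suc r"]
      arg_cong[OF hdim_Suc[OF assms, of r], of "\<lambda>x. n * x"] sum_hdim[OF assms, of r]
    by (simp add: algebra_simps)
qed simp

lemma sum_hdim_square:
  assumes "n \<ge> 1"
  shows "(n + 2) * ((n + 1) * (\<Sum>k\<le>r. (real r + 1 - k)\<^sup>2 * hdim n k)) =
    (r + n + 1) * (2 * r + n + 2) * (\<Sum>k\<le>r. hdim n k)"
proof (induction r)
  case 0
  then show ?case by (simp add: algebra_simps)
next
  case (Suc r)
  let ?H = "\<Sum>k\<le>r. hdim n k" and ?V = "\<Sum>k\<le>r. (real r + 1 - k) * hdim n k"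
    and ?U = "\<Sum>k\<le>r. (real r + 1 - k)\<^sup>2 * hdim n k" and ?h = "hdim n (Suc r)"
  \<comment> \<open>Raising a weight \<open>w\<close> by one adds \<open>2 * w + 1\<close> to its
    square; the new index \<open>Suc r\<close> enters with weight 1.\<close>
  have U: "(\<Sum>k\<le>Suc r. (real (Suc r) + 1 - k)\<^sup>2 * hdim n k) = ?U + 2 * ?V + ?H + ?h"
    by (simp add: sum.distrib[symmetric] sum_distrib_left algebra_simps power2_eq_square)
  have V: "(n + 1) * ?V = (r + n + 1) * ?H"
    using sum_hdim_linear[OF assms, of r] by (simp add: add_ac)
  have H: "(r + 1) * ?h = n * ?H"
    using sum_hdim[OF assms, of r] hdim_Suc[OF assms, of r] by (simp add: algebra_simps)
  have "(n + 2) * ((n + 1) * (?U + 2 * ?V + ?H + ?h)) =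
      (n + 2) * ((n + 1) * ?U) + 2 * (n + 2) * ((n + 1) * ?V) + (n + 2) * (n + 1) * (?H + ?h)"
    by (simp add: algebra_simps)
  also have "\<dots> = (r + n + 1) * (2 * r + n + 2) * ?H + 2 * (n + 2) * (r + n + 1) * ?H
      + (n + 2) * (n + 1) * (?H + ?h)"
    using Suc V
    by (simp only: of_nat_add of_nat_mult of_nat_1 of_nat_numeral)
  also have "\<dots> = (Suc r + n + 1) * (2 * Suc r + n + 2) * (?H + ?h)"
    using H by (simp add: distrib_left distrib_right) algebra
  finally show ?case unfolding U by (simp add: algebra_simps)
qed

text \<open>The closed forms give \<open>(n + 1) * (n + 2)\<close> times the right-hand sum as a
  quadratic in \<open>r\<close> times the left-hand sum. That quadratic is at least
  \<open>4 * r^2\<close>, and \<open>(n + 1) * (n + 2)\<close> is at most \<open>8 * n^2\<close>;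
  the quotient of these constants is the factor 2.\<close>

lemma ultra_test_bound:
  assumes "n \<ge> 1"
  shows "(real r)\<^sup>2 * (\<Sum>k\<le>r. hdim n k) \<le> 2 * (real n)\<^sup>2 * (\<Sum>k\<le>r. (real r + 1 - k)\<^sup>2 * sdim n k)"
proof -
  let ?H = "\<Sum>k\<le>r. hdim n k" and ?U = "\<lambda>r. \<Sum>k\<le>r. (real r + 1 - k)\<^sup>2 * hdim n k"
  \<comment> \<open>The second summand of \<open>sdim\<close> is shifted by one index, which yields
    the same kind of sum with \<open>r - 1\<close> in place of \<open>r\<close>.\<close>
  have S: "(\<Sum>k\<le>r. (real r + 1 - k)\<^sup>2 * sdim n k) = ?U r + (\<Sum>k<r. (real r - k)\<^sup>2 * hdim n k)"
  proof -
    have "(\<Sum>k\<le>m. (real r + 1 - k)\<^sup>2 * sdim n k) =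
        (\<Sum>k\<le>m. (real r + 1 - k)\<^sup>2 * hdim n k) + (\<Sum>k<m. (real r - k)\<^sup>2 * hdim n k)" for m
      by (induction m) (auto simp: sdim_def algebra_simps)
    then show ?thesis .
  qed
  have H0: "?H \<ge> 0"
    by (intro sum_nonneg less_imp_le hdim_pos assms)
  have "(n + 2) * ((n + 1) * (\<Sum>k<r. (real r - k)\<^sup>2 * hdim n k)) = r * (2 * r + n) * ?H"
  proof (cases r)
    case (Suc j)
    have sums: "(\<Sum>k<r. (real r - k)\<^sup>2 * hdim n k) = (\<Sum>k\<le>j. (real j + 1 - k)\<^sup>2 * hdim n k)"
      by (simp add: Suc lessThan_Suc_atMost add_ac)
    have H: "(real j + 1) * ?H = (real j + n + 1) * (\<Sum>k\<le>j. hdim n k)"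
      using sum_hdim[OF assms, of j] hdim_Suc[OF assms, of j] Suc by (simp add: algebra_simps)
    have "(real n + 2) * ((real n + 1) * (\<Sum>k<r. (real r - k)\<^sup>2 * hdim n k)) =
        (2 * real j + n + 2) * ((real j + n + 1) * (\<Sum>k\<le>j. hdim n k))"
      unfolding sums using sum_hdim_square[OF assms, of j] by (simp add: mult_ac)
    also have "\<dots> = r * (2 * r + n) * ?H"
      unfolding H[symmetric] using Suc by (simp add: algebra_simps)
    finally show ?thesis by (simp add: add_ac)
  qed simp
  then have "(n + 2) * ((n + 1) * (\<Sum>k\<le>r. (real r + 1 - k)\<^sup>2 * sdim n k)) =
      ((r + n + 1) * (2 * r + n + 2) + r * (2 * r + n)) * ?H"
    unfolding S using sum_hdim_square[OF assms, of r] by (simp add: algebra_simps)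
  moreover have "real ((r + n + 1) * (2 * r + n + 2) + r * (2 * r + n)) * ?H \<ge> 4 * (real r)\<^sup>2 * ?H"
  proof (rule mult_right_mono[OF _ H0])
    have "4 * r\<^sup>2 \<le> (r + n + 1) * (2 * r + n + 2) + r * (2 * r + n)"
      by (simp add: algebra_simps power2_eq_square)
    then have "real (4 * r\<^sup>2) \<le> real ((r + n + 1) * (2 * r + n + 2) + r * (2 * r + n))"
      by (rule of_nat_mono)
    then show "4 * (real r)\<^sup>2 \<le> real ((r + n + 1) * (2 * r + n + 2) + r * (2 * r + n))"
      by simp
  qed
  ultimately have 1: "4 * (real r)\<^sup>2 * ?H \<le> (real n + 2) * ((real n + 1) * (\<Sum>k\<le>r. (real r + 1 - k)\<^sup>2 * sdim n k))"
    by (simp add: add_ac)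
  have "(real n + 2) * (real n + 1) \<le> 8 * (real n)\<^sup>2"
  proof -
    have "real n \<le> (real n)\<^sup>2" "1 \<le> (real n)\<^sup>2"
      using assms by (auto simp: self_le_power)
    then show ?thesis by (simp add: algebra_simps power2_eq_square)
  qed
  then have "(real n + 2) * (real n + 1) * (\<Sum>k\<le>r. (real r + 1 - k)\<^sup>2 * sdim n k)
      \<le> 8 * (real n)\<^sup>2 * (\<Sum>k\<le>r. (real r + 1 - k)\<^sup>2 * sdim n k)"
    by (intro mult_right_mono sum_nonneg) (auto intro!: mult_nonneg_nonneg less_imp_le[OF sdim_pos[OF assms]])
  then show ?thesis using 1 by simp
qed

text \<open>The coefficients are proportional to \<open>r + 1 - k\<close>: they vanish at
  \<open>r + 1\<close> as the Dirichlet form requires, and all their consecutive differences are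
  equal. The quantifier order makes one \<open>p\<close> serve every functional, hence every centre
  \<open>u\<close>.\<close>

lemma exists_concentrated_poly:
  assumes "n \<ge> 1"
  shows "\<exists>p. degree p \<le> r \<and> (\<forall>l. ultra_functional n l \<longrightarrow>
    l (p\<^sup>2) = 1 \<and> (real r)\<^sup>2 * l ([:1, -1:] * p\<^sup>2) \<le> 2 * (real n)\<^sup>2)"
proof -
  define S where "S = (\<Sum>k\<le>r. (real r + 1 - k)\<^sup>2 * sdim n k)"
  define c where "c = (\<lambda>k. (real r + 1 - real k) / sqrt S)"
  define p where "p = (\<Sum>k\<le>r. smult (c k * sdim n k) (ultra n k))"
  have "S > 0" unfolding S_def
    by (rule sum_pos) (auto intro!: mult_pos_pos sdim_pos assms)
  then have S2: "(sqrt S)\<^sup>2 = S" by simp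
  have "degree p \<le> r" unfolding p_def
    by (intro degree_sum_le) (auto intro: order.trans[OF degree_smult_le] order.trans[OF degree_ultra])
  moreover have "l (p\<^sup>2) = 1 \<and> (real r)\<^sup>2 * l ([:1, -1:] * p\<^sup>2) \<le> 2 * (real n)\<^sup>2"
    if "ultra_functional n l" for l
  proof -
    interpret ultra_functional n l by fact
    have "l (p\<^sup>2) = S / S"
      unfolding p_def l_test_square
      by (simp add: c_def power_divide S2 sum_divide_distrib[symmetric] S_def[symmetric])
    moreover have "l ([:1, -1:] * p\<^sup>2) = (\<Sum>k\<le>r. hdim n k) / S"
    proof -
      have "c k - c (Suc k) = 1 / sqrt S" for k
        by (simp add: c_def diff_divide_distrib[symmetric])
      then show ?thesis
        unfolding p_def by (subst l_test_one_minus_X) (auto simp: c_def power_divide S2 sum_divide_distrib)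
    qed
    ultimately show ?thesis
      using ultra_test_bound[OF assms, of r] \<open>S > 0\<close> unfolding S_def[symmetric]
      by (simp del: mult_pCons_left add: pos_divide_le_eq)
  qed
  ultimately show ?thesis by blast
qed

section \<open>Growth of trigonometric polynomials at a zero minimum\<close>

text \<open>A geometric sum over the powers of an \<open>N\<close>-th root of unity, which differs
  from 1 because \<open>N\<close> does not divide \<open>m\<close>.\<close>

lemma sum_cis_roots_eq_0:
  fixes m :: int and N :: nat
  assumes "m \<noteq> 0" "\<bar>m\<bar> < int N"
  shows "(\<Sum>j<N. cis (m * (2 * pi * j / N))) = 0"
proof -
  let ?w = "cis (2 * pi * m / N)"
  have N: "real N > 0" using assms by simp
  have "?w \<noteq> 1"
  proof
    assume "?w = 1"
    then have "cos (2 * pi * m / N) = 1" by (simp add: complex_eq_iff)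
    then obtain k :: int where "2 * pi * m / N = k * (2 * pi)"
      by (auto simp: cos_one_2pi_int)
    then have "real_of_int m = k * N" using N by (simp add: field_simps)
    then have "m = k * int N"
      by (metis of_int_eq_iff of_int_mult of_int_of_nat_eq)
    then show False using assms by (auto simp: abs_mult)
  qed
  moreover have "?w ^ N = 1"
    using N cis_multiple_2pi[of "of_int m"] by (simp add: Complex.DeMoivre)
  ultimately have "(\<Sum>j<N. ?w ^ j) = 0"
    by (simp add: geometric_sum)
  then show ?thesis
    by (simp add: Complex.DeMoivre mult_ac)
qed

text \<open>The index \<open>k\<close> stands for the frequency \<open>k - d\<close>, so that
  frequencies from \<open>-d\<close> to \<open>d\<close> are indexed by naturals.\<close>

definition trig_sum :: "nat \<Rightarrow> (nat \<Rightarrow> complex) \<Rightarrow> real \<Rightarrow> complex" where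
  "trig_sum d w \<theta> = (\<Sum>k\<le>2 * d. w k * cis ((real k - real d) * \<theta>))"

text \<open>Discrete Parseval identity on \<open>2 * d + 1\<close> equidistant points. It is exact
  because two frequencies differ by at most \<open>2 * d\<close>, which is less than
  \<open>N\<close>.\<close>

lemma trig_sum_parseval:
  fixes N :: nat
  assumes N: "N = 2 * d + 1"
  shows "(\<Sum>j<N. (cmod (trig_sum d w (2 * pi * j / N)))\<^sup>2) = N * (\<Sum>k\<le>2 * d. (cmod (w k))\<^sup>2)"
proof -
  have "complex_of_real (\<Sum>j<N. (cmod (trig_sum d w (2 * pi * j / N)))\<^sup>2) =
      (\<Sum>j<N. \<Sum>k\<le>2 * d. \<Sum>l\<le>2 * d. w k * cnj (w l) * cis ((int k - int l) * (2 * pi * j / N)))"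
    unfolding of_real_sum complex_norm_square trig_sum_def cnj_sum sum_product
  proof (intro sum.cong refl)
    fix j k l
    have "cis ((real k - real d) * (2 * pi * j / N)) * cis (- ((real l - real d) * (2 * pi * j / N))) =
        cis ((int k - int l) * (2 * pi * j / N))"
      unfolding cis_mult by (rule arg_cong[of _ _ cis]) (simp add: algebra_simps add_divide_distrib diff_divide_distrib)
    then show "w k * cis ((real k - real d) * (2 * pi * j / N)) *
        cnj (w l * cis ((real l - real d) * (2 * pi * j / N))) =
        w k * cnj (w l) * cis ((int k - int l) * (2 * pi * j / N))"
      by (simp add: cis_cnj mult_ac)
  qed
  also have "\<dots> = (\<Sum>k\<le>2 * d. \<Sum>l\<le>2 * d. w k * cnj (w l) * (\<Sum>j<N. cis ((int k - int l) * (2 * pi * j / N))))"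
    unfolding sum_distrib_left
    by (subst sum.swap, rule sum.cong[OF refl], subst sum.swap, rule refl)
  also have "\<dots> = (\<Sum>k\<le>2 * d. \<Sum>l\<le>2 * d. if l = k then N * (w k * cnj (w k)) else 0)"
  proof (intro sum.cong refl)
    fix k l assume "k \<in> {..2 * d}" "l \<in> {..2 * d}"
    then show "w k * cnj (w l) * (\<Sum>j<N. cis ((int k - int l) * (2 * pi * j / N))) =
        (if l = k then N * (w k * cnj (w k)) else 0)"
      using sum_cis_roots_eq_0[of "int k - int l" N] N by auto
  qed
  also have "\<dots> = of_real (N * (\<Sum>k\<le>2 * d. (cmod (w k))\<^sup>2))"
    by (simp add: sum_distrib_left complex_norm_square[symmetric])
  finally show ?thesis by (simp only: of_real_eq_iff)
qed

text \<open>The constant is fixed by \<open>d = 2\<close>, where equality holds; the induction step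
  adds the two extreme frequencies.\<close>

lemma sum_fourth_powers:
  "d \<ge> 2 \<Longrightarrow> 32 * (\<Sum>k\<le>2 * d. (real k - real d) ^ 4) \<le> 17 * real d ^ 6"
proof (induction d rule: dec_induct)
  case base
  have "{..4::nat} = {0,1,2,3,4}" by auto
  then show ?case by simp
next
  case (step d)
  have "(\<Sum>k\<le>2 * Suc d. (real k - real (Suc d)) ^ 4) =
      (\<Sum>k\<le>2 * d. (real k - real d) ^ 4) + 2 * (real d + 1) ^ 4"
  proof -
    have "2 * Suc d = Suc (Suc (2 * d))" by simp
    then have "(\<Sum>k\<le>2 * Suc d. (real k - real (Suc d)) ^ 4) =
        (\<Sum>k\<le>Suc (2 * d). (real k - real (Suc d)) ^ 4) + (real (Suc (Suc (2 * d))) - real (Suc d)) ^ 4"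
      by (simp only: sum.atMost_Suc)
    also have "(\<Sum>k\<le>Suc (2 * d). (real k - real (Suc d)) ^ 4) =
        (real 0 - real (Suc d)) ^ 4 + (\<Sum>k\<le>2 * d. (real (Suc k) - real (Suc d)) ^ 4)"
      by (rule sum.atMost_Suc_shift)
    also have "(real 0 - real (Suc d)) ^ 4 = (- (real d + 1)) ^ 4" by (simp add: add_ac)
    also have "(- (real d + 1)) ^ 4 = (real d + 1) ^ 4" by (rule power_minus_even) simp
    also have "(real (Suc (Suc (2 * d))) - real (Suc d)) ^ 4 = (real d + 1) ^ 4" by (simp add: add_ac)
    finally show ?thesis by simp
  qed
  moreover have "64 * (real d + 1) ^ 4 \<le> 17 * ((real d + 1) ^ 6 - real d ^ 6)"
  proof -
    \<comment> \<open>In powers of \<open>d - 2\<close> the difference of the two sides has only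
      positive coefficients.\<close>
    define x where "x = real d - 2"
    have "x \<ge> 0" "real d = x + 2" using step by (auto simp: x_def)
    then show ?thesis by (simp add: field_simps power_numeral_reduce)
  qed
  ultimately show ?case using step by (simp add: add_ac)
qed

text \<open>Taylor expansion to order four with \<open>x^4 \<le> x^2\<close>; the constant is
  \<open>1/2 - 1/24\<close>.\<close>

lemma one_minus_cos_ge:
  fixes x :: real
  assumes "\<bar>x\<bar> \<le> 1"
  shows "1 - cos x \<ge> 11 / 24 * x\<^sup>2"
proof -
  obtain t where "cos x = (\<Sum>m<4. cos_coeff m * x ^ m) + (cos (t + 1/2 * real 4 * pi) / fact 4) * x ^ 4"
    using Maclaurin_cos_expansion[of x 4] by auto
  moreover have "(\<Sum>m<4. cos_coeff m * x ^ m) = 1 - x\<^sup>2 / 2"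
    by (simp add: lessThan_nat_numeral cos_coeff_def fact_numeral)
  moreover have "(cos (t + 1/2 * real 4 * pi) / fact 4) * x ^ 4 \<le> x\<^sup>2 / 24"
  proof -
    have "(cos (t + 1/2 * real 4 * pi) / fact 4) * x ^ 4 \<le> 1 / 24 * x ^ 4"
      by (intro mult_right_mono) (auto simp: fact_numeral)
    also have "x ^ 4 = x\<^sup>2 * x\<^sup>2" by (simp flip: power_add)
    also have "x\<^sup>2 * x\<^sup>2 \<le> x\<^sup>2 * 1"
      using assms by (intro mult_left_mono) (auto simp: abs_square_le_1)
    finally show ?thesis by simp
  qed
  ultimately show ?thesis by simp
qed

text \<open>\<open>T - M / 2\<close> is bounded by \<open>M / 2\<close>, so Parseval bounds its
  coefficients in the l2 norm. Cauchy-Schwarz against the squared frequencies then bounds the second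
  derivative by a multiple of \<open>M * d^3\<close>, and Taylor's formula at the minimum gives the
  claim for angles up to 1. For larger angles the bound exceeds \<open>M\<close>. The case
  \<open>d = 1\<close> is computed explicitly.\<close>

lemma trig_sum_growth:
  fixes T :: "real \<Rightarrow> real"
  assumes d: "d \<ge> 1" and T: "\<And>\<theta>. complex_of_real (T \<theta>) = trig_sum d w \<theta>"
    and nonneg: "\<And>\<theta>. T \<theta> \<ge> 0" and le: "\<And>\<theta>. T \<theta> \<le> M" and "T 0 = 0"
    and \<theta>: "0 \<le> \<theta>" "\<theta> \<le> pi"
  shows "T \<theta> \<le> M / 2 * real d ^ 3 * (1 - cos \<theta>)"
proof -
  \<comment> \<open>\<open>D m\<close> is the \<open>m\<close>-th derivative of \<open>T\<close>,
    differentiated term by term.\<close>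
  define D where "D = (\<lambda>m \<theta>. \<Sum>k\<le>2 * d. Re (w k * (\<i> * of_real (real k - real d)) ^ m *
    cis ((real k - real d) * \<theta>)))"
  have D0: "D 0 = T"
  proof
    fix \<theta>
    show "D 0 \<theta> = T \<theta>"
      using arg_cong[OF T[of \<theta>], of Re] by (simp add: D_def trig_sum_def)
  qed
  have DERIV: "(D m has_real_derivative D (Suc m) \<theta>) (at \<theta>)" for m \<theta>
    unfolding D_def
  proof (rule DERIV_sum)
    fix k
    define a c where "a = real k - real d" and "c = w k * (\<i> * of_real a) ^ m"
    have "((\<lambda>\<theta>. Re c * cos (a * \<theta>) - Im c * sin (a * \<theta>)) has_real_derivative
        (- a * Im c * cos (a * \<theta>) - a * Re c * sin (a * \<theta>))) (at \<theta>)"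
      by (auto intro!: derivative_eq_intros)
    then have "((\<lambda>\<theta>. Re (c * cis (a * \<theta>))) has_real_derivative Re (c * (\<i> * of_real a) * cis (a * \<theta>))) (at \<theta>)"
      by (simp add: algebra_simps)
    moreover have "w k * (\<i> * of_real a) ^ Suc m = c * (\<i> * of_real a)"
      by (simp add: c_def mult_ac)
    ultimately show "((\<lambda>\<theta>. Re (w k * (\<i> * of_real (real k - real d)) ^ m * cis ((real k - real d) * \<theta>)))
        has_real_derivative
        Re (w k * (\<i> * of_real (real k - real d)) ^ Suc m * cis ((real k - real d) * \<theta>))) (at \<theta>)"
      by (simp only: a_def c_def)
  qed
  have D1: "D 1 0 = 0"
  proof (rule DERIV_local_min[where d = 1])
    show "(T has_real_derivative D 1 0) (at 0)" using DERIV[of 0 0] D0 by simp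
  qed (use nonneg \<open>T 0 = 0\<close> in auto)
  have M: "M \<ge> 0" using nonneg[of 0] le[of 0] by linarith
  show ?thesis
  proof (cases "d = 1")
    case True
    have ts: "trig_sum d w x = w 0 * cis (- x) + w 1 + w 2 * cis x" for x
      using True by (simp add: trig_sum_def eval_nat_numeral)
    have w012: "w 0 + w 1 + w 2 = 0"
      using T[of 0] \<open>T 0 = 0\<close> unfolding ts by simp
    moreover have "T pi = Re (- w 0 + w 1 - w 2)"
      using arg_cong[OF T[of pi], of Re] unfolding ts by simp
    moreover have "Im (w 0) = Im (w 2)"
      using D1 True by (simp add: D_def eval_nat_numeral)
    \<comment> \<open>This comes from \<open>T\<close> being real: the values at 0 and
      \<open>pi\<close> force the imaginary part of \<open>w 1\<close> to vanish, and the value at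
      \<open>pi / 2\<close> then compares the real parts.\<close>
    moreover have "Re (w 0) = Re (w 2)"
    proof -
      have "Im (w 0 * cis (- (pi / 2)) + w 1 + w 2 * cis (pi / 2)) = 0"
        using arg_cong[OF T[of "pi / 2"], of Im] unfolding ts by simp
      moreover have "Im (w 0) + Im (w 1) + Im (w 2) = 0"
        using arg_cong[OF w012, of Im] by simp
      moreover have "Im (w 0 * cis (- pi) + w 1 + w 2 * cis pi) = 0"
        using arg_cong[OF T[of "pi"], of Im] unfolding ts by simp
      ultimately show ?thesis by simp
    qed
    moreover have "T \<theta> = Re (w 0 * cis (- \<theta>) + w 1 + w 2 * cis \<theta>)"
      using arg_cong[OF T[of \<theta>], of Re] unfolding ts by simp
    ultimately have "Re (w 1) = - 2 * Re (w 2)" "T pi = - 4 * Re (w 2)"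
      "T \<theta> = - 2 * Re (w 2) + cos \<theta> * (2 * Re (w 2))"
      by (auto simp: complex_eq_iff algebra_simps)
    then have "T \<theta> = T pi / 2 * (1 - cos \<theta>)"
      by (simp add: algebra_simps)
    also have "\<dots> \<le> M / 2 * (1 - cos \<theta>)"
      using le[of pi] by (intro mult_right_mono) auto
    finally show ?thesis using True by simp
  next
    case False
    then have d2: "d \<ge> 2" using d by simp
    \<comment> \<open>The coefficients of \<open>T - M / 2\<close>; index \<open>d\<close> carries
      frequency 0.\<close>
    define v where "v = (\<lambda>k. w k - (if k = d then of_real (M / 2) else 0))"
    have v: "trig_sum d v x = of_real (T x - M / 2)" for x
    proof -
      have "trig_sum d v x = trig_sum d w x - (\<Sum>k\<le>2 * d. if k = d then of_real (M / 2) else 0)"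
        unfolding trig_sum_def v_def sum_subtractf[symmetric]
        by (intro sum.cong refl) (auto simp: algebra_simps)
      then show ?thesis using T[of x] by simp
    qed
    have "(2 * d + 1) * (\<Sum>k\<le>2 * d. (cmod (v k))\<^sup>2) \<le> (\<Sum>j<2 * d + 1. (M / 2)\<^sup>2)"
      unfolding trig_sum_parseval[OF refl, symmetric]
    proof (rule sum_mono)
      fix j
      have "\<bar>T x - M / 2\<bar> \<le> \<bar>M / 2\<bar>" for x
        using nonneg[of x] le[of x] M by (simp add: abs_if)
      then have "(T x - M / 2)\<^sup>2 \<le> (M / 2)\<^sup>2" for x
        by (simp only: abs_le_square_iff)
      then show "(cmod (trig_sum d v (2 * pi * real j / real (2 * d + 1))))\<^sup>2 \<le> (M / 2)\<^sup>2"
        unfolding v norm_of_real power2_abs .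
    qed
    also have "\<dots> = (2 * d + 1) * (M / 2)\<^sup>2" by simp
    finally have "real (2 * d + 1) * (\<Sum>k\<le>2 * d. (cmod (v k))\<^sup>2) \<le> real (2 * d + 1) * (M / 2)\<^sup>2"
      by simp
    then have bessel: "(\<Sum>k\<le>2 * d. (cmod (v k))\<^sup>2) \<le> (M / 2)\<^sup>2"
      by (rule mult_left_le_imp_le) simp
    have D2: "\<bar>D 2 x\<bar> \<le> 11 / 24 * M * real d ^ 3" for x
    proof -
      have "\<bar>D 2 x\<bar> \<le> (\<Sum>k\<le>2 * d. \<bar>cmod (v k)\<bar> * \<bar>(real k - real d)\<^sup>2\<bar>)"
        unfolding D_def
      proof (rule order.trans[OF sum_abs], rule sum_mono)
        fix k
        let ?a = "real k - real d"
        have "\<bar>Re (w k * (\<i> * of_real ?a)\<^sup>2 * cis (?a * x))\<bar> \<le>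
            cmod (w k * (\<i> * of_real ?a)\<^sup>2 * cis (?a * x))"
          by (rule abs_Re_le_cmod)
        also have "\<dots> = cmod (w k) * ?a\<^sup>2"
          by (simp only: norm_mult norm_power norm_ii norm_of_real norm_cis power2_abs mult_1_left mult_1_right)
        \<comment> \<open>\<open>v\<close> and \<open>w\<close> differ only at \<open>k = d\<close>,
          where the frequency is 0.\<close>
        also have "\<dots> = \<bar>cmod (v k)\<bar> * \<bar>?a\<^sup>2\<bar>"
          by (auto simp: v_def)
        finally show "\<bar>Re (w k * (\<i> * of_real ?a)\<^sup>2 * cis (?a * x))\<bar> \<le> \<bar>cmod (v k)\<bar> * \<bar>?a\<^sup>2\<bar>" .
      qed
      also have "\<dots> \<le> L2_set (\<lambda>k. cmod (v k)) {..2 * d} * L2_set (\<lambda>k. (real k - real d)\<^sup>2) {..2 * d}"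
        by (rule L2_set_mult_ineq)
      also have "L2_set (\<lambda>k. cmod (v k)) {..2 * d} \<le> M / 2"
        unfolding L2_set_def using bessel M by (intro real_le_lsqrt) auto
      \<comment> \<open>The factor 11/12 is chosen so that the resulting 11/24 matches
        \<open>one_minus_cos_ge\<close>; it is admissible since 17/32 is at most its square.\<close>
      also have "L2_set (\<lambda>k. (real k - real d)\<^sup>2) {..2 * d} \<le> 11 / 12 * real d ^ 3"
        unfolding L2_set_def
      proof (intro real_le_lsqrt)
        show "(\<Sum>k\<le>2 * d. ((real k - real d)\<^sup>2)\<^sup>2) \<le> (11 / 12 * real d ^ 3)\<^sup>2"
        proof -
          have "real d ^ 6 \<ge> 0" by simp
          then have "144 * (\<Sum>k\<le>2 * d. (real k - real d) ^ 4) \<le> 121 * real d ^ 6"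
            using sum_fourth_powers[OF d2] by linarith
          then show ?thesis
            by (simp add: power_mult_distrib power_divide flip: power_mult)
        qed
      qed auto
      finally show ?thesis using M by (simp add: mult_left_mono mult_right_mono)
    qed
    show ?thesis
    proof (cases "\<theta> \<le> 1")
      case True
      obtain t where "T \<theta> = (\<Sum>m<2. (D m 0 / fact m) * \<theta> ^ m) + (D 2 t / fact 2) * \<theta> ^ 2"
        using Maclaurin_all_le[of D T \<theta> 2] D0 DERIV by blast
      then have "T \<theta> = D 2 t / 2 * \<theta>\<^sup>2"
        using D1 \<open>T 0 = 0\<close> by (simp add: eval_nat_numeral D0)
      also have "\<dots> \<le> (11 / 24 * M * real d ^ 3) / 2 * \<theta>\<^sup>2"
        using D2[of t] by (intro mult_right_mono divide_right_mono) auto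
      also have "\<dots> = M / 2 * real d ^ 3 * (11 / 24 * \<theta>\<^sup>2)" by simp
      also have "\<dots> \<le> M / 2 * real d ^ 3 * (1 - cos \<theta>)"
        using one_minus_cos_ge[of \<theta>] True \<theta> M by (intro mult_left_mono) auto
      finally show ?thesis .
    next
      case False
      have "cos \<theta> \<le> cos 1" using False \<theta> by (intro cos_monotone_0_pi_le) auto
      then have c: "1 - cos \<theta> \<ge> 11 / 24" using one_minus_cos_ge[of 1] by simp
      have "real d ^ 3 \<ge> 2 ^ 3" using d2 by (intro power_mono) auto
      \<comment> \<open>The right-hand side is \<open>11/6 * M\<close>, which already exceeds the
        trivial bound \<open>M\<close>.\<close>
      then have "M / 2 * real d ^ 3 * (1 - cos \<theta>) \<ge> M / 2 * 2 ^ 3 * (11 / 24)"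
        using c M by (intro mult_mono) auto
      then show ?thesis using le[of \<theta>] M by simp
    qed
  qed
qed

text \<open>Multiplying by \<open>cis (d * \<theta>)\<close> shifts the frequencies to
  \<open>0, ..., 2 * d\<close>, so a trigonometric polynomial becomes an ordinary polynomial in
  \<open>cis \<theta>\<close>, and closure under sums and products reduces to
  \<open>poly\<close>.\<close>

definition trig_poly :: "nat \<Rightarrow> (real \<Rightarrow> real) \<Rightarrow> bool" where
  "trig_poly d T \<longleftrightarrow> (\<exists>W. degree W \<le> 2 * d \<and>
    (\<forall>\<theta>. complex_of_real (T \<theta>) * cis (real d * \<theta>) = poly W (cis \<theta>)))"

lemma trig_poly_sum:
  assumes "trig_poly d T"
  obtains w where "\<And>\<theta>. complex_of_real (T \<theta>) = trig_sum d w \<theta>"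
proof -
  obtain W where W: "degree W \<le> 2 * d" "\<And>\<theta>. complex_of_real (T \<theta>) * cis (real d * \<theta>) = poly W (cis \<theta>)"
    using assms by (auto simp: trig_poly_def)
  have "complex_of_real (T \<theta>) = trig_sum d (coeff W) \<theta>" for \<theta>
  proof -
    have "complex_of_real (T \<theta>) = poly W (cis \<theta>) * cis (- (real d * \<theta>))"
      by (simp add: W(2)[symmetric] mult.assoc cis_mult)
    also have "poly W (cis \<theta>) = (\<Sum>k\<le>2 * d. coeff W k * cis (k * \<theta>))"
      unfolding poly_altdef using W(1)
      by (intro sum.mono_neutral_cong_left) (auto simp: Complex.DeMoivre coeff_eq_0)
    finally show ?thesis
      by (simp add: trig_sum_def sum_distrib_right mult.assoc cis_mult left_diff_distrib)
  qed
  then show ?thesis by (rule that)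
qed

lemma trig_poly_mono:
  assumes "trig_poly d T" "d \<le> e"
  shows "trig_poly e T"
proof -
  obtain W where W: "degree W \<le> 2 * d" "\<And>\<theta>. complex_of_real (T \<theta>) * cis (real d * \<theta>) = poly W (cis \<theta>)"
    using assms by (auto simp: trig_poly_def)
  have "degree (W * monom 1 (e - d)) \<le> 2 * e"
    using W(1) assms(2) degree_mult_le[of W "monom 1 (e - d)"] degree_monom_le[of "1::complex" "e - d"] by linarith
  moreover have "complex_of_real (T \<theta>) * cis (real e * \<theta>) = poly (W * monom 1 (e - d)) (cis \<theta>)" for \<theta>
  proof -
    have "cis (real e * \<theta>) = cis (real d * \<theta>) * cis \<theta> ^ (e - d)"
      using assms(2) by (simp add: Complex.DeMoivre cis_mult of_nat_diff algebra_simps)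
    then show ?thesis by (simp add: W(2)[symmetric] poly_monom mult.assoc)
  qed
  ultimately show ?thesis unfolding trig_poly_def by blast
qed

lemma trig_poly_const: "trig_poly 0 (\<lambda>_. c)"
  unfolding trig_poly_def by (rule exI[of _ "[:of_real c:]"]) simp

lemma trig_poly_add:
  assumes "trig_poly d S" "trig_poly d T"
  shows "trig_poly d (\<lambda>\<theta>. S \<theta> + T \<theta>)"
proof -
  obtain V W where "degree V \<le> 2 * d" "\<And>\<theta>. complex_of_real (S \<theta>) * cis (real d * \<theta>) = poly V (cis \<theta>)"
    "degree W \<le> 2 * d" "\<And>\<theta>. complex_of_real (T \<theta>) * cis (real d * \<theta>) = poly W (cis \<theta>)"
    using assms by (auto simp: trig_poly_def)
  then show ?thesis unfolding trig_poly_def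
    by (intro exI[of _ "V + W"]) (auto simp: degree_add_le distrib_right)
qed

lemma trig_poly_mult:
  assumes "trig_poly d S" "trig_poly e T"
  shows "trig_poly (d + e) (\<lambda>\<theta>. S \<theta> * T \<theta>)"
proof -
  obtain V W where "degree V \<le> 2 * d" "\<And>\<theta>. complex_of_real (S \<theta>) * cis (real d * \<theta>) = poly V (cis \<theta>)"
    "degree W \<le> 2 * e" "\<And>\<theta>. complex_of_real (T \<theta>) * cis (real e * \<theta>) = poly W (cis \<theta>)"
    using assms by (auto simp: trig_poly_def)
  moreover from this have "complex_of_real (S \<theta> * T \<theta>) * cis (real (d + e) * \<theta>) = poly (V * W) (cis \<theta>)" for \<theta>
  proof -
    have "cis (real (d + e) * \<theta>) = cis (real d * \<theta>) * cis (real e * \<theta>)"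
      by (simp add: cis_mult algebra_simps)
    then show ?thesis using \<open>\<And>\<theta>. complex_of_real (S \<theta>) * cis (real d * \<theta>) = poly V (cis \<theta>)\<close>[of \<theta>, symmetric]
      \<open>\<And>\<theta>. complex_of_real (T \<theta>) * cis (real e * \<theta>) = poly W (cis \<theta>)\<close>[of \<theta>, symmetric] by (simp add: mult_ac)
  qed
  ultimately show ?thesis unfolding trig_poly_def
    using degree_mult_le[of V W] by (intro exI[of _ "V * W"]) auto
qed

lemma trig_poly_linear: "trig_poly 1 (\<lambda>\<theta>. a * cos \<theta> + b * sin \<theta>)"
proof -
  \<comment> \<open>With \<open>z = cis \<theta>\<close>,
    \<open>z * cos \<theta> = (z^2 + 1) / 2\<close> and
    \<open>z * sin \<theta> = (z^2 - 1) / (2 * \<i>)\<close>.\<close>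
  let ?W = "[:of_real a / 2 - of_real b / (2 * \<i>), 0, of_real a / 2 + of_real b / (2 * \<i>):]"
  have "complex_of_real (a * cos \<theta> + b * sin \<theta>) * cis \<theta> = poly ?W (cis \<theta>)" for \<theta>
  proof -
    have "sin \<theta> * sin \<theta> = 1 - cos \<theta> * cos \<theta>"
      using sin_squared_eq[of \<theta>] by (simp add: power2_eq_square)
    then show ?thesis
      by (simp add: complex_eq_iff) algebra
  qed
  then show ?thesis unfolding trig_poly_def by (intro exI[of _ ?W]) auto
qed

lemma trig_poly_power: "trig_poly d T \<Longrightarrow> trig_poly (k * d) (\<lambda>\<theta>. T \<theta> ^ k)"
  by (induction k) (auto simp: trig_poly_const[of 1, simplified] trig_poly_mult)

lemma trig_poly_prod:
  "finite A \<Longrightarrow> (\<And>i. i \<in> A \<Longrightarrow> trig_poly (d i) (T i)) \<Longrightarrow>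
    trig_poly (\<Sum>i\<in>A. d i) (\<lambda>\<theta>. \<Prod>i\<in>A. T i \<theta>)"
  by (induction A rule: finite_induct) (auto simp: trig_poly_const[of 1, simplified] trig_poly_mult)

lemma trig_poly_sum_set:
  "finite A \<Longrightarrow> (\<And>i. i \<in> A \<Longrightarrow> trig_poly d (T i)) \<Longrightarrow> trig_poly d (\<lambda>\<theta>. \<Sum>i\<in>A. T i \<theta>)"
  by (induction A rule: finite_induct) (auto intro: trig_poly_add trig_poly_mono[OF trig_poly_const])

section \<open>Integration by parts on the ball\<close>

text \<open>The last coordinate of the point of the upper hemisphere above \<open>x\<close>; the
  density of the ball measure is proportional to its reciprocal. Outside the ball
  \<open>sqrt\<close> takes negative values and stays continuous, so \<open>height\<close> is
  continuous everywhere.\<close>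

definition height :: "'a::euclidean_space \<Rightarrow> real" where
  "height x = sqrt (1 - (norm x)\<^sup>2)"

lemma continuous_height [continuous_intros]: "continuous_on A height"
  unfolding height_def by (intro continuous_intros)

lemma measurable_height [measurable]: "height \<in> borel_measurable borel"
  by (intro borel_measurable_continuous_onI continuous_height)

lemma height_eq_0: "norm x = 1 \<Longrightarrow> height x = 0"
  by (simp add: height_def)

lemma height_pos: "norm x < 1 \<Longrightarrow> height x > 0"
  by (simp add: height_def abs_square_less_1)

lemma height_nonneg: "norm x \<le> 1 \<Longrightarrow> height x \<ge> 0"
  by (simp add: height_def abs_square_le_1)

lemma height_square: "norm x \<le> 1 \<Longrightarrow> (height x)\<^sup>2 = 1 - (norm x)\<^sup>2"
  by (simp add: height_def abs_square_le_1)

section \<open>Integrability of the weight\<close>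

lemma emeasure_shell_le:
  fixes k :: nat
  defines "S \<equiv> cball (0::'a::euclidean_space) 1 - ball 0 (sqrt (1 - (1/4) ^ k))"
  shows "emeasure lborel S \<le> ennreal (unit_ball_vol DIM('a) * DIM('a) * (1/4) ^ k)"
proof -
  define q :: real where "q = 1 - (1/4) ^ k"
  have q: "0 \<le> q" "q \<le> 1" by (auto simp: q_def power_le_one)
  have sub: "ball (0::'a) (sqrt q) \<subseteq> cball 0 1"
    using q by (intro order.trans[OF ball_subset_cball] subset_cball) auto
  have "emeasure lborel S = emeasure lborel (cball (0::'a) 1) - emeasure lborel (ball (0::'a) (sqrt q))"
    unfolding S_def q_def[symmetric]
    by (rule emeasure_Diff) (use sub emeasure_lborel_ball_finite[of "0::'a" "sqrt q"] in \<open>auto simp: less_top\<close>)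
  also have "\<dots> = ennreal (unit_ball_vol DIM('a)) - ennreal (unit_ball_vol DIM('a) * sqrt q ^ DIM('a))"
    using q by (simp add: emeasure_cball emeasure_ball)
  also have "\<dots> = ennreal (unit_ball_vol DIM('a) * (1 - sqrt q ^ DIM('a)))"
    using q by (subst ennreal_minus) (auto simp: right_diff_distrib)
  also have "\<dots> \<le> ennreal (unit_ball_vol DIM('a) * DIM('a) * (1/4) ^ k)"
  proof (rule ennreal_leI)
    \<comment> \<open>Bernoulli's inequality is applied to \<open>q\<close>, while the inner radius
      of the shell is \<open>sqrt q\<close>; \<open>q \<le> sqrt q\<close> bridges the two.\<close>
    have "1 + real DIM('a) * (- ((1/4) ^ k)) \<le> (1 + - ((1/4) ^ k)) ^ DIM('a)"
      by (rule Bernoulli_inequality) (simp add: power_le_one)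
    also have "\<dots> = q ^ DIM('a)" by (simp add: q_def)
    also have "q \<le> sqrt q"
      using q by (metis abs_of_nonneg real_sqrt_abs real_sqrt_le_mono mult_left_le power2_eq_square)
    then have "q ^ DIM('a) \<le> sqrt q ^ DIM('a)"
      using q by (intro power_mono) auto
    finally have "1 - sqrt q ^ DIM('a) \<le> DIM('a) * (1/4) ^ k" by simp
    then show "unit_ball_vol DIM('a) * (1 - sqrt q ^ DIM('a)) \<le> unit_ball_vol DIM('a) * DIM('a) * (1/4) ^ k"
      unfolding mult.assoc by (intro mult_left_mono) auto
  qed
  finally show ?thesis .
qed

text \<open>Dyadic decomposition: where \<open>1 - norm x ^ 2\<close> lies between
  \<open>4^(-k-1)\<close> and \<open>4^(-k)\<close>, the integrand is at most \<open>2^(k+1)\<close>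
  and the shell has volume of order \<open>4^(-k)\<close>, so a geometric series of ratio 1/2
  dominates.\<close>

lemma integrable_inverse_height:
  "integrable lborel (\<lambda>x::'a::euclidean_space. indicator (cball 0 1) x / height x)"
proof (rule integrableI_bounded)
  define S where "S = (\<lambda>k. cball (0::'a) 1 - ball 0 (sqrt (1 - (1/4) ^ k)))"
  define V where "V = unit_ball_vol DIM('a)"
  have [measurable]: "S k \<in> sets borel" for k by (simp add: S_def)
  have "(\<integral>\<^sup>+x. ennreal (norm (indicator (cball (0::'a) 1) x / height x)) \<partial>lborel) \<le>
      (\<integral>\<^sup>+x. (suminf (\<lambda>k. ennreal (2 ^ Suc k) * indicator (S k) x)) \<partial>lborel)"
  proof (rule nn_integral_mono)
    fix x :: 'a
    show "ennreal (norm (indicator (cball 0 1) x / height x)) \<le> (suminf (\<lambda>k. ennreal (2 ^ Suc k) * indicator (S k) x))"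
    proof (cases "norm x < 1")
      case True
      define u where "u = 1 - (norm x)\<^sup>2"
      have u: "0 < u" "u \<le> 1" using True by (auto simp: u_def abs_square_less_1)
      obtain m where "(1/4) ^ m < u"
        using real_arch_pow_inv[OF u(1), of "1/4"] by auto
      moreover have "(1/4) ^ Suc m \<le> (1/4 :: real) ^ m"
        by simp
      ultimately have "\<exists>k. (1/4) ^ Suc k < u"
        by (intro exI[of _ m]) linarith
      \<comment> \<open>Minimality of \<open>k\<close> supplies the reverse bound
        \<open>u \<le> (1/4) ^ k\<close>, which places \<open>x\<close> in shell
        \<open>k\<close>.\<close>
      then obtain k where k: "(1/4) ^ Suc k < u" "\<And>j. j < k \<Longrightarrow> \<not> (1/4) ^ Suc j < u"
        using exists_least_iff[of "\<lambda>k. (1/4) ^ Suc k < u"] by blast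
      have le: "u \<le> (1/4) ^ k"
        using k(2)[of "k - 1"] u by (cases k) (auto simp: not_less)
      have "x \<in> S k"
      proof -
        have "1 - (1/4) ^ k \<le> (norm x)\<^sup>2" using le by (simp add: u_def)
        then have "sqrt (1 - (1/4) ^ k) \<le> norm x"
          by (intro real_le_lsqrt) (auto simp: power_le_one)
        then show ?thesis using True by (auto simp: S_def)
      qed
      have "(1 / 2 ^ Suc k)\<^sup>2 \<le> u"
        using k(1) by (simp add: power_divide power_mult[symmetric] mult.commute[of _ 2])
          (simp add: power_mult power_one_over)
      then have "1 / 2 ^ Suc k \<le> height x"
        unfolding height_def u_def[symmetric] by (intro real_le_rsqrt)
      then have "1 / height x \<le> 2 ^ Suc k"
        using height_pos[OF True] by (simp add: field_simps)
      then have "ennreal (norm (indicator (cball 0 1) x / height x)) \<le> ennreal (2 ^ Suc k) * indicator (S k) x"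
        using \<open>x \<in> S k\<close> True height_pos[OF True] by (simp add: ennreal_leI)
      also have "\<dots> \<le> (suminf (\<lambda>k. ennreal (2 ^ Suc k) * indicator (S k) x))"
      proof -
        have "f k \<le> suminf f" for f :: "nat \<Rightarrow> ennreal"
          using sum_le_suminf[of f "{k}"] by simp
        then show ?thesis .
      qed
      finally show ?thesis .
    next
      case False
      then have "indicator (cball 0 1) x / height x = 0"
        by (cases "norm x = 1") (auto simp: height_eq_0)
      then have "ennreal (norm (indicator (cball 0 1) x / height x)) = 0"
        by (simp only: norm_zero ennreal_0)
      then show ?thesis by (simp only: zero_le)
    qed
  qed
  also have "\<dots> = (suminf (\<lambda>k. \<integral>\<^sup>+x. ennreal (2 ^ Suc k) * indicator (S k) x \<partial>lborel))"
    by (rule nn_integral_suminf) measurable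
  also have "\<dots> = (suminf (\<lambda>k. ennreal (2 ^ Suc k) * emeasure lborel (S k)))"
    by (intro suminf_cong nn_integral_cmult_indicator) (simp add: S_def)
  also have "\<dots> \<le> (suminf (\<lambda>k. ennreal (2 * V * DIM('a) * (1/2) ^ k)))"
  proof (intro suminf_le)
    fix k
    have "ennreal (2 ^ Suc k) * emeasure lborel (S k) \<le> ennreal (2 ^ Suc k) * ennreal (V * DIM('a) * (1/4) ^ k)"
      unfolding S_def V_def by (intro mult_left_mono emeasure_shell_le) auto
    also have "\<dots> = ennreal (2 * V * DIM('a) * (1/2) ^ k)"
    proof -
      have "(2::real) ^ k * (1/4) ^ k = (1/2) ^ k" by (simp flip: power_mult_distrib)
      then show ?thesis by (simp add: ennreal_mult'[symmetric] mult_ac)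
    qed
    finally show "ennreal (2 ^ Suc k) * emeasure lborel (S k) \<le> ennreal (2 * V * DIM('a) * (1/2) ^ k)" .
  qed auto
  also have "\<dots> = ennreal (suminf (\<lambda>k. 2 * V * DIM('a) * (1/2) ^ k))"
    by (rule suminf_ennreal2) (auto simp: V_def intro!: summable_mult summable_geometric)
  also have "\<dots> < \<infinity>" by simp
  finally show "(\<integral>\<^sup>+x. ennreal (norm (indicator (cball (0::'a) 1) x / height x)) \<partial>lborel) < \<infinity>" .
qed (auto intro!: borel_measurable_divide borel_measurable_indicator)

section \<open>Vanishing integral of a directional derivative\<close>

lemma lborel_translation:
  fixes f :: "'a::euclidean_space \<Rightarrow> real"
  assumes "f \<in> borel_measurable borel"
  shows "(\<integral>x. f (x + c) \<partial>lborel) = (\<integral>x. f x \<partial>lborel)"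
    and "integrable lborel f \<Longrightarrow> integrable lborel (\<lambda>x. f (x + c))"
proof -
  show "(\<integral>x. f (x + c) \<partial>lborel) = (\<integral>x. f x \<partial>lborel)"
    using integral_distr[of "(+) c" lborel borel f] assms by (simp add: lborel_distr_plus add.commute)
  show "integrable lborel f \<Longrightarrow> integrable lborel (\<lambda>x. f (x + c))"
    using integrable_distr_eq[of "(+) c" lborel borel f] assms by (simp add: lborel_distr_plus add.commute)
qed

text \<open>A quadratic equation in \<open>v\<close> with nonzero leading coefficient. These are the
  exceptional points when the fundamental theorem of calculus is applied along the line.\<close>

lemma finite_line_meets_sphere:
  fixes x e :: "'a::euclidean_space"
  assumes "e \<noteq> 0"
  shows "finite {v. norm (x + v *\<^sub>R e) = 1}"
proof -
  let ?p = "[:x \<bullet> x - 1, 2 * (x \<bullet> e), e \<bullet> e:]"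
  have "{v. norm (x + v *\<^sub>R e) = 1} \<subseteq> {v. poly ?p v = 0}"
    by (auto simp: norm_eq_1 inner_add_left inner_add_right inner_commute algebra_simps)
  moreover have "finite {v. poly ?p v = 0}"
    using assms by (intro poly_roots_finite) auto
  ultimately show ?thesis by (rule finite_subset)
qed

text \<open>Integrating over the segments \<open>x + [0, 1] e\<close> first and over \<open>x\<close> second evaluates the
  double integral to \<open>0\<close>, since \<open>K\<close> extended by \<open>0\<close> is translated; in the other order it is the
  integral in question.\<close>

lemma integral_derivative_ball:
  fixes K D :: "'a::euclidean_space \<Rightarrow> real" and e :: 'a
  assumes K: "continuous_on (cball 0 1) K" and K0: "\<And>x. norm x = 1 \<Longrightarrow> K x = 0"
    and D: "continuous_on UNIV D"
    and deriv: "\<And>x. norm x < 1 \<Longrightarrow>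
      ((\<lambda>v. K (x + v *\<^sub>R e)) has_real_derivative D x / height x) (at 0)"
  shows "(\<integral>x. indicator (ball 0 1) x * (D x / height x) \<partial>lborel) = 0"
proof (cases "e = 0")
  case True
  have "D x / height x = 0" if "norm x < 1" for x
    using DERIV_unique[OF deriv[OF that], of 0] True by simp
  then have "(\<lambda>x. indicator (ball 0 1) x * (D x / height x)) = (\<lambda>x. 0)"
    by (auto simp: fun_eq_iff indicator_def)
  then show ?thesis by (simp del: mult_eq_0_iff divide_eq_0_iff)
next
  case False
  define W where "W = (\<lambda>x. indicator (ball 0 1) x * (D x / height x))"
  define K' where "K' = (\<lambda>x. if norm x \<le> 1 then K x else 0)"
  have [measurable]: "D \<in> borel_measurable borel"
    using D by (rule borel_measurable_continuous_onI)
  have [measurable]: "W \<in> borel_measurable borel"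
    unfolding W_def
    by (intro borel_measurable_times borel_measurable_indicator borel_measurable_divide) auto
  obtain C where C: "\<And>x. norm x \<le> 1 \<Longrightarrow> \<bar>D x\<bar> \<le> C" "C > 0"
  proof -
    have "bounded (D ` cball 0 1)"
      by (intro compact_imp_bounded compact_continuous_image continuous_on_subset[OF D]) auto
    then obtain b where "b > 0" "\<forall>x\<in>cball 0 1. \<bar>D x\<bar> \<le> b"
      unfolding bounded_pos by auto
    then show ?thesis by (intro that[of b]) auto
  qed
  have W: "integrable lborel W"
  proof (rule Bochner_Integration.integrable_bound)
    show "integrable lborel (\<lambda>x::'a. C * (indicator (cball 0 1) x / height x))"
      by (intro integrable_mult_right integrable_inverse_height)
    show "AE x in lborel. norm (W x) \<le> norm (C * (indicator (cball 0 1) x / height x))"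
    proof (intro AE_I2)
      fix x :: 'a
      show "norm (W x) \<le> norm (C * (indicator (cball 0 1) x / height x))"
        using C(1)[of x] C(2) height_pos[of x]
        by (auto simp: W_def indicator_def abs_mult intro!: divide_right_mono)
    qed
  qed measurable
  \<comment> \<open>Extension by 0 is continuous because \<open>K\<close> vanishes on the
    sphere.\<close>
  have K': "continuous_on UNIV K'"
  proof -
    have "continuous_on (cball 0 1 \<union> - ball 0 1) (\<lambda>x. if norm x \<le> 1 then K x else 0)"
      by (intro continuous_on_cases K) (auto simp: K0 intro!: antisym)
    moreover have "cball 0 1 \<union> - ball 0 1 = (UNIV :: 'a set)" by auto
    ultimately show ?thesis by (simp add: K'_def)
  qed
  then have [measurable]: "K' \<in> borel_measurable borel"
    by (rule borel_measurable_continuous_onI)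
  have K'_int: "integrable lborel K'"
  proof -
    have "integrable lborel (\<lambda>x. indicator (cball 0 1) x *\<^sub>R K x)"
      using borel_integrable_compact[OF _ K] by (simp add: set_integrable_def)
    moreover have "(\<lambda>x. indicator (cball 0 1) x *\<^sub>R K x) = K'"
      by (auto simp: K'_def indicator_def)
    ultimately show ?thesis by simp
  qed
  \<comment> \<open>Off the finitely many crossings of the sphere, \<open>K'\<close> is
    differentiable along the segment: with the given derivative inside the ball, with derivative 0
    outside. \<open>W\<close> may blow up at the crossings, but \<open>K'\<close> is continuous
    there.\<close>
  have ftc: "((\<lambda>v. W (x + v *\<^sub>R e)) has_integral (K' (x + e) - K' x)) {0..1}" for x
  proof -
    have "((\<lambda>v. W (x + v *\<^sub>R e)) has_integral (K' (x + 1 *\<^sub>R e) - K' (x + 0 *\<^sub>R e))) {0..1}"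
    proof (rule fundamental_theorem_of_calculus_interior_strong[OF finite_line_meets_sphere[OF False, of x]])
      show "continuous_on {0..1} (\<lambda>v. K' (x + v *\<^sub>R e))"
        by (intro continuous_on_compose2[OF K'] continuous_intros) auto
    next
      fix v assume "v \<in> {0<..<1} - {v. norm (x + v *\<^sub>R e) = 1}"
      then consider "norm (x + v *\<^sub>R e) < 1" | "norm (x + v *\<^sub>R e) > 1"
        by fastforce
      then have "((\<lambda>v. K' (x + v *\<^sub>R e)) has_real_derivative W (x + v *\<^sub>R e)) (at v)"
      proof cases
        case 1
        have "((\<lambda>u. K (x + u *\<^sub>R e)) has_real_derivative W (x + v *\<^sub>R e)) (at (0 + v))"
          unfolding DERIV_shift using deriv[OF 1] 1
          by (simp add: W_def scaleR_left_distrib add_ac)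
        then have d: "((\<lambda>u. K (x + u *\<^sub>R e)) has_real_derivative W (x + v *\<^sub>R e)) (at v)" by simp
        show ?thesis
        proof (rule has_field_derivative_transform_within_open[OF d])
          show "open {u. norm (x + u *\<^sub>R e) < 1}"
            by (intro open_Collect_less continuous_intros)
        qed (use 1 in \<open>auto simp: K'_def\<close>)
      next
        case 2
        have d: "((\<lambda>u. 0) has_real_derivative 0) (at v)" by simp
        have "((\<lambda>v. K' (x + v *\<^sub>R e)) has_real_derivative 0) (at v)"
        proof (rule has_field_derivative_transform_within_open[OF d])
          show "open {u. norm (x + u *\<^sub>R e) > 1}"
            by (intro open_Collect_less continuous_intros)
        qed (use 2 in \<open>auto simp: K'_def\<close>)
        then show ?thesis using 2 by (simp add: W_def)
      qed
      then show "((\<lambda>v. K' (x + v *\<^sub>R e)) has_vector_derivative W (x + v *\<^sub>R e)) (at v)"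
        by (simp add: has_real_derivative_iff_has_vector_derivative)
    qed simp
    then show ?thesis by simp
  qed
  define F where "F = (\<lambda>v x. indicator {0..1::real} v * W (x + v *\<^sub>R e))"
  have F_meas [measurable]: "case_prod F \<in> borel_measurable (lborel \<Otimes>\<^sub>M lborel)"
    unfolding F_def by measurable
  have F_int: "integrable (lborel \<Otimes>\<^sub>M lborel) (case_prod F)"
  proof (rule lborel_pair.Fubini_integrable)
    have "(\<lambda>v. \<integral>x. norm (case_prod F (v, x)) \<partial>lborel) = (\<lambda>v. indicator {0..1} v * (\<integral>x. \<bar>W x\<bar> \<partial>lborel))"
      using lborel_translation(1)[of "\<lambda>x. \<bar>W x\<bar>"] by (auto simp: F_def abs_mult)
    then show "integrable lborel (\<lambda>v. \<integral>x. norm (case_prod F (v, x)) \<partial>lborel)"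
      by (simp add: integrable_mult_left_iff)
    show "AE v in lborel. integrable lborel (\<lambda>x. case_prod F (v, x))"
      using lborel_translation(2)[OF _ W] by (auto simp: F_def)
  qed measurable
  have "(\<integral>v. (\<integral>x. F v x \<partial>lborel) \<partial>lborel) = (\<integral>v. indicator {0..1::real} v * (\<integral>x. W x \<partial>lborel) \<partial>lborel)"
    using lborel_translation(1)[of W] by (auto simp: F_def)
  then have 1: "(\<integral>v. (\<integral>x. F v x \<partial>lborel) \<partial>lborel) = (\<integral>x. W x \<partial>lborel)"
    by simp
  have "(\<integral>x. (\<integral>v. F v x \<partial>lborel) \<partial>lborel) = (\<integral>x. K' (x + e) - K' x \<partial>lborel)"
  proof (rule integral_cong_AE)
    have "AE x in lborel. integrable lborel (\<lambda>v. F v x)"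
      using lborel_pair.AE_integrable_snd[OF F_int] by simp
    then show "AE x in lborel. (\<integral>v. F v x \<partial>lborel) = K' (x + e) - K' x"
    proof eventually_elim
      case (elim x)
      then have "((\<lambda>v. F v x) has_integral (\<integral>v. F v x \<partial>lborel)) UNIV"
        by (rule has_integral_integral_lborel)
      moreover have "((\<lambda>v. F v x) has_integral (K' (x + e) - K' x)) UNIV"
      proof -
        have "(\<lambda>v. F v x) = (\<lambda>v. if v \<in> {0..1} then W (x + v *\<^sub>R e) else 0)"
          by (auto simp: F_def)
        then show ?thesis using ftc[of x] by (simp only: has_integral_restrict_UNIV)
      qed
      ultimately show ?case by (rule has_integral_unique)
    qed
    have "(\<lambda>x. \<integral>v. F v x \<partial>lborel) \<in> borel_measurable lborel"
      using lborel.borel_measurable_lebesgue_integral[of "\<lambda>x v. F v x" lborel] F_meas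
      by measurable
    then show "(\<lambda>x. \<integral>v. F v x \<partial>lborel) \<in> borel_measurable lborel" .
  qed measurable
  also have "\<dots> = 0"
    using lborel_translation[of K' e] K'_int by (simp add: Bochner_Integration.integral_diff)
  finally show ?thesis
    using 1 lborel_pair.Fubini_integral[OF F_int] by (simp add: W_def)
qed

section \<open>The ball measure as a projection of the sphere\<close>

text \<open>On the unit sphere both sides are 0, by the conventions for \<open>powr\<close> at 0 and
  for division by 0.\<close>

lemma ball_weight:
  fixes x :: "real ^ 'n::finite"
  assumes "norm x \<le> 1"
  shows "(1 - (norm x)\<^sup>2) powr (- 1 / 2) = 1 / height x"
  using assms by (simp add: height_def powr_minus_divide powr_half_sqrt abs_square_le_1)

lemma ball_const:
  "ball_const TYPE('n::finite) = 1 / (\<integral>x. indicator (cball 0 1) (x::real ^ 'n) / height x \<partial>lborel)"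
  unfolding ball_const_def set_lebesgue_integral_def
  by (rule arg_cong[of _ _ "\<lambda>z. 1 / z"], rule Bochner_Integration.integral_cong)
     (auto simp: ball_weight[simplified] indicator_def)

lemma integral_inverse_height_pos:
  "(\<integral>x. indicator (cball 0 1) (x::'a::euclidean_space) / height x \<partial>lborel) > 0"
proof -
  have "0 < measure lborel (ball (0::'a) 1)"
    using content_ball_pos[of 1 "0::'a"] by simp
  also have "\<dots> = (\<integral>x. indicator (ball 0 1) (x::'a) \<partial>lborel)" by simp
  also have "\<dots> \<le> (\<integral>x. indicator (cball 0 1) (x::'a) / height x \<partial>lborel)"
  proof (rule integral_mono[OF _ integrable_inverse_height])
    fix x :: 'a
    have "height x \<le> 1" by (simp add: height_def)
    then show "indicator (ball 0 1) x \<le> indicator (cball 0 1) x / height x"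
      using height_pos[of x] height_nonneg[of x] by (auto simp: indicator_def)
  qed (use emeasure_lborel_ball_finite[of "0::'a" 1] in auto)
  finally show ?thesis .
qed

lemma ball_const_pos: "ball_const TYPE('n::finite) > 0"
  unfolding ball_const using integral_inverse_height_pos by simp

definition ball_density :: "real ^ 'n::finite \<Rightarrow> real" where
  "ball_density x = ball_const TYPE('n) * (indicator (cball 0 1) x / height x)"

lemma ball_measure_eq: "ball_measure = density lborel (\<lambda>x. ennreal (ball_density x))"
  unfolding ball_measure_def
  by (rule arg_cong[of _ _ "density lborel"])
     (auto simp: fun_eq_iff ball_weight[simplified] ball_density_def indicator_def)

lemma measurable_ball_density [measurable]: "ball_density \<in> borel_measurable borel"
  unfolding ball_density_def
  by (intro borel_measurable_times borel_measurable_divide borel_measurable_indicator) auto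

lemma ball_density_nonneg: "0 \<le> ball_density x"
  using height_nonneg[of x] ball_const_pos[where 'n = 'a]
  by (auto simp: ball_density_def indicator_def)

lemma sets_ball_measure [measurable_cong, simp]: "sets ball_measure = sets borel"
  by (simp add: ball_measure_def)

lemma space_ball_measure [simp]: "space ball_measure = UNIV"
  by (simp add: ball_measure_def)

lemma emeasure_ball_measure: "emeasure (ball_measure :: (real ^ 'n::finite) measure) UNIV = 1"
proof -
  have "emeasure (ball_measure :: (real ^ 'n) measure) UNIV = (\<integral>\<^sup>+x. ennreal (ball_density (x :: real ^ 'n)) \<partial>lborel)"
    unfolding ball_measure_eq by (subst emeasure_density) auto
  also have "\<dots> = ennreal (\<integral>x. ball_density (x :: real ^ 'n) \<partial>lborel)"
    by (intro nn_integral_eq_integral AE_I2 ball_density_nonneg)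
       (auto simp: ball_density_def[abs_def] simp del: times_divide_eq_right
         intro!: integrable_mult_right integrable_inverse_height)
  also have "\<dots> = 1"
    unfolding ball_density_def integral_mult_right_zero
    using integral_inverse_height_pos[where 'a = "real ^ 'n"] by (simp add: ball_const)
  finally show ?thesis .
qed

lemma finite_measure_ball: "finite_measure (ball_measure :: (real ^ 'n::finite) measure)"
  by (rule finite_measureI) (simp add: emeasure_ball_measure)

lemma measure_ball_measure: "measure (ball_measure :: (real ^ 'n::finite) measure) UNIV = 1"
  by (simp add: measure_def emeasure_ball_measure)

lemma AE_ball_measure: "AE x in (ball_measure :: (real ^ 'n::finite) measure). norm x \<le> 1"
  unfolding ball_measure_eq
  by (subst AE_density) (auto simp: ball_density_def indicator_def)

lemma integrable_ball:
  fixes g :: "real ^ 'n::finite \<Rightarrow> real"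
  assumes "continuous_on UNIV g"
  shows "integrable ball_measure g"
proof -
  interpret finite_measure "ball_measure :: (real ^ 'n) measure" by (rule finite_measure_ball)
  have "bounded (g ` cball 0 1)"
    by (intro compact_imp_bounded compact_continuous_image continuous_on_subset[OF assms]) auto
  then obtain C where "\<forall>x\<in>cball 0 1. \<bar>g x\<bar> \<le> C"
    unfolding bounded_iff by auto
  then have C: "\<And>x. norm x \<le> 1 \<Longrightarrow> \<bar>g x\<bar> \<le> C" by simp
  have "g \<in> borel_measurable ball_measure"
    using borel_measurable_continuous_onI[OF assms] by measurable
  then show ?thesis
    using AE_ball_measure C by (intro integrable_const_bound[of _ C]) auto
qed

lemma integral_ball:
  fixes g :: "real ^ 'n::finite \<Rightarrow> real"
  assumes "continuous_on UNIV g"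
  shows "(\<integral>x. g x \<partial>ball_measure) =
    ball_const TYPE('n) * (\<integral>x. indicator (ball 0 1) x * (g x / height x) \<partial>lborel)"
proof -
  have [measurable]: "g \<in> borel_measurable borel"
    using assms by (rule borel_measurable_continuous_onI)
  have "(\<integral>x. g x \<partial>ball_measure) =
      (\<integral>x. ball_density x *\<^sub>R g x \<partial>lborel)"
    unfolding ball_measure_eq
    by (rule integral_density) (auto intro: ball_density_nonneg)
  also have "\<dots> = (\<integral>x. ball_const TYPE('n) * (indicator (ball 0 1) x * (g x / height x)) \<partial>lborel)"
  proof (intro Bochner_Integration.integral_cong refl)
    fix x :: "real ^ 'n"
    show "ball_density x *\<^sub>R g x =
        ball_const TYPE('n) * (indicator (ball 0 1) x * (g x / height x))"
      \<comment> \<open>The closed ball can be replaced by the open one because division by the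
        height 0 gives 0 on the sphere.\<close>
      using height_eq_0[of x] by (cases "norm x = 1") (auto simp: ball_density_def indicator_def)
  qed
  finally show ?thesis by (simp only: integral_mult_right_zero)
qed

lemma integral_ball_cong:
  fixes g h :: "real ^ 'n::finite \<Rightarrow> real"
  assumes "continuous_on UNIV g" "continuous_on UNIV h" "\<And>x. norm x \<le> 1 \<Longrightarrow> g x = h x"
  shows "(\<integral>x. g x \<partial>ball_measure) = (\<integral>x. h x \<partial>ball_measure)"
proof (rule integral_cong_AE)
  show "AE x in ball_measure. g x = h x"
    using AE_ball_measure by eventually_elim (use assms in auto)
qed (use integrable_ball[OF assms(1)] integrable_ball[OF assms(2)] in auto)

lemma integral_ball_mono:
  fixes g h :: "real ^ 'n::finite \<Rightarrow> real"
  assumes "continuous_on UNIV g" "continuous_on UNIV h" "\<And>x. norm x \<le> 1 \<Longrightarrow> g x \<le> h x"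
  shows "(\<integral>x. g x \<partial>ball_measure) \<le> (\<integral>x. h x \<partial>ball_measure)"
proof (rule integral_mono_AE)
  show "AE x in ball_measure. g x \<le> h x"
    using AE_ball_measure by eventually_elim (use assms in auto)
qed (use integrable_ball[OF assms(1)] integrable_ball[OF assms(2)] in auto)

text \<open>The mean over the unit sphere of the product space, written through the two points above
  each \<open>x\<close>. Its rotation invariance enters in infinitesimal form, in
  \<open>sphere_mean_rotation\<close>.\<close>

definition sphere_mean :: "((real ^ 'n::finite) \<times> real \<Rightarrow> real) \<Rightarrow> real" where
  "sphere_mean \<Phi> = (\<integral>x. (\<Phi> (x, height x) + \<Phi> (x, - height x)) / 2 \<partial>ball_measure)"

lemma norm_height: "norm x \<le> 1 \<Longrightarrow> norm (x, height x) = 1" "norm x \<le> 1 \<Longrightarrow> norm (x, - height x) = 1"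
  by (simp_all add: norm_prod_def height_square)

lemma continuous_sphere_integrand:
  fixes \<Phi> :: "(real ^ 'n::finite) \<times> real \<Rightarrow> real"
  assumes "continuous_on UNIV \<Phi>"
  shows "continuous_on UNIV (\<lambda>x. (\<Phi> (x, height x) + \<Phi> (x, - height x)) / 2)"
  by (intro continuous_intros continuous_on_compose2[OF assms] continuous_height) auto

lemma sphere_mean_add:
  assumes "continuous_on UNIV \<Phi>" "continuous_on UNIV \<Psi>"
  shows "sphere_mean (\<lambda>z. \<Phi> z + \<Psi> z) = sphere_mean \<Phi> + sphere_mean \<Psi>"
  unfolding sphere_mean_def
  unfolding Bochner_Integration.integral_add[symmetric,
      OF assms[THEN continuous_sphere_integrand, THEN integrable_ball]]
  by (intro Bochner_Integration.integral_cong refl) (simp add: add_divide_distrib)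

lemma sphere_mean_cmult: "sphere_mean (\<lambda>z. c * \<Phi> z) = c * sphere_mean \<Phi>"
  unfolding sphere_mean_def
  by (subst integral_mult_right_zero[symmetric]) (auto intro!: Bochner_Integration.integral_cong simp: algebra_simps)

lemma sphere_mean_diff:
  assumes "continuous_on UNIV \<Phi>" "continuous_on UNIV \<Psi>"
  shows "sphere_mean (\<lambda>z. \<Phi> z - \<Psi> z) = sphere_mean \<Phi> - sphere_mean \<Psi>"
  using sphere_mean_add[OF assms(1), of "\<lambda>z. - 1 * \<Psi> z"] assms(2)
  by (simp only: sphere_mean_cmult) (auto intro!: continuous_intros)

lemma sphere_mean_sum:
  assumes "finite A" "\<And>i. i \<in> A \<Longrightarrow> continuous_on UNIV (\<Phi> i)"
  shows "sphere_mean (\<lambda>z. \<Sum>i\<in>A. \<Phi> i z) = (\<Sum>i\<in>A. sphere_mean (\<Phi> i))"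
  using assms
proof (induction A rule: finite_induct)
  case empty
  then show ?case using sphere_mean_cmult[of 0 "\<lambda>_. 0"] by simp
next
  case (insert i A)
  then show ?case by (simp add: sphere_mean_add continuous_on_sum)
qed

lemma sphere_mean_const: "sphere_mean (\<lambda>_. c :: real) = c"
  by (simp add: sphere_mean_def measure_ball_measure)

lemma sphere_mean_cong:
  assumes "continuous_on UNIV \<Phi>" "continuous_on UNIV \<Psi>" "\<And>z. norm z = 1 \<Longrightarrow> \<Phi> z = \<Psi> z"
  shows "sphere_mean \<Phi> = sphere_mean \<Psi>"
  unfolding sphere_mean_def
  by (intro integral_ball_cong continuous_sphere_integrand assms(1,2))
     (simp add: assms(3) norm_height)

lemma sphere_mean_mono:
  assumes "continuous_on UNIV \<Phi>" "continuous_on UNIV \<Psi>" "\<And>z. norm z = 1 \<Longrightarrow> \<Phi> z \<le> \<Psi> z"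
  shows "sphere_mean \<Phi> \<le> sphere_mean \<Psi>"
  unfolding sphere_mean_def
  by (intro integral_ball_mono continuous_sphere_integrand assms(1,2) divide_right_mono add_mono)
     (simp_all add: assms(3) norm_height)

text \<open>The vector field \<open>(s e, - e \<bullet> x)\<close> generates the rotations in the plane of \<open>e\<close> and the last
  coordinate.\<close>

lemma sphere_mean_rotation:
  fixes G :: "(real ^ 'n::finite) \<times> real \<Rightarrow> real" and e :: "real ^ 'n"
  assumes G: "\<And>z. (G has_derivative G' z) (at z)"
    and R: "\<And>z. R z = G' z (snd z *\<^sub>R e, - (fst z \<bullet> e))" and cont: "continuous_on UNIV R"
  shows "sphere_mean R = 0"
proof -
  \<comment> \<open>The two sheets agree over the boundary sphere, so half their difference vanishes
    there, as \<open>integral_derivative_ball\<close> demands.\<close>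
  define K where "K = (\<lambda>x. (G (x, height x) - G (x, - height x)) / 2)"
  define D where "D = (\<lambda>x. (R (x, height x) + R (x, - height x)) / 2)"
  have G_cont: "continuous_on UNIV G"
    using G by (intro differentiable_imp_continuous_on) (auto simp: differentiable_on_def differentiable_def)
  have "(\<integral>x. indicator (ball 0 1) x * (D x / height x) \<partial>lborel) = 0"
  proof (rule integral_derivative_ball)
    show "continuous_on (cball 0 1) K"
      unfolding K_def by (intro continuous_intros continuous_on_compose2[OF G_cont] continuous_height) auto
    show "K x = 0" if "norm x = 1" for x using that by (simp add: K_def height_eq_0)
    show "continuous_on UNIV D"
      unfolding D_def by (intro continuous_sphere_integrand cont)
    show "((\<lambda>v. K (x + v *\<^sub>R e)) has_real_derivative D x / height x) (at 0)" if x: "norm x < 1" for x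
    proof -
      have pos: "height x > 0" using x by (rule height_pos)
      have hsq: "height x = sqrt (1 - x \<bullet> x)" for x :: "real ^ 'n"
        by (simp add: height_def power2_norm_eq_inner)
      have h: "((\<lambda>v. height (x + v *\<^sub>R e)) has_derivative (\<lambda>v. v * (- (x \<bullet> e) / height x))) (at 0)"
        unfolding hsq using pos[unfolded hsq]
        by (auto intro!: derivative_eq_intros simp: inner_commute divide_simps)
      have l: "((\<lambda>v. x + v *\<^sub>R e) has_derivative (\<lambda>v. v *\<^sub>R e)) (at 0)"
        by (auto intro!: derivative_eq_intros)
      have G1: "((\<lambda>v. G (x + v *\<^sub>R e, height (x + v *\<^sub>R e))) has_derivative
          (\<lambda>v. G' (x, height x) (v *\<^sub>R e, v * (- (x \<bullet> e) / height x)))) (at 0)"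
        using has_derivative_compose[OF has_derivative_Pair[OF l h], of G "G' (x, height x)"] G[of "(x, height x)"]
        by simp
      have G2: "((\<lambda>v. G (x + v *\<^sub>R e, - height (x + v *\<^sub>R e))) has_derivative
          (\<lambda>v. G' (x, - height x) (v *\<^sub>R e, - (v * (- (x \<bullet> e) / height x))))) (at 0)"
        using has_derivative_compose[OF has_derivative_Pair[OF l has_derivative_minus[OF h]], of G "G' (x, - height x)"]
          G[of "(x, - height x)"] by simp
      have lin: "linear (G' z)" for z
        using G[of z] by (rule has_derivative_linear)
      \<comment> \<open>Moving \<open>x\<close> along \<open>e\<close> moves the upper lift with
        velocity equal to the rotation field divided by \<open>height x\<close>.\<close>
      have 1: "G' (x, height x) (v *\<^sub>R e, v * (- (x \<bullet> e) / height x)) = v * (R (x, height x) / height x)" for v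
      proof -
        have "(v *\<^sub>R e, v * (- (x \<bullet> e) / height x)) = (v / height x) *\<^sub>R (height x *\<^sub>R e, - (x \<bullet> e))"
          using pos by simp
        then show ?thesis by (simp add: R linear_scale[OF lin] del: scaleR_Pair)
      qed
      \<comment> \<open>On the lower sheet the velocity is the field divided by
        \<open>- height x\<close>; this sign is the reason for taking a difference in
        \<open>K\<close>.\<close>
      have 2: "G' (x, - height x) (v *\<^sub>R e, - (v * (- (x \<bullet> e) / height x))) = - (v * (R (x, - height x) / height x))" for v
      proof -
        have "(v *\<^sub>R e, - (v * (- (x \<bullet> e) / height x))) = (- v / height x) *\<^sub>R (- height x *\<^sub>R e, - (x \<bullet> e))"
          using pos by simp
        then show ?thesis by (simp only: linear_scale[OF lin]) (simp add: R)
      qed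
      have "((\<lambda>v. K (x + v *\<^sub>R e)) has_derivative (\<lambda>v. v * (D x / height x))) (at 0)"
        unfolding K_def
        using has_derivative_mult_right[OF has_derivative_diff[OF G1 G2], of "1 / 2"]
        unfolding 1 2 by (simp add: D_def add_divide_distrib diff_divide_distrib algebra_simps)
      then show ?thesis
        unfolding has_field_derivative_def
        by (rule has_derivative_eq_rhs) (simp add: fun_eq_iff)
    qed
  qed
  then show ?thesis
    unfolding sphere_mean_def D_def
    by (subst integral_ball) (auto intro!: continuous_sphere_integrand cont)
qed

section \<open>Zonal functions\<close>

lemma pderiv_sum: "pderiv (\<Sum>i\<in>A. f i) = (\<Sum>i\<in>A. pderiv (f i))"
  by (induction A rule: infinite_finite_induct) (auto simp: pderiv_add)

lemma pderiv_surj: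
  fixes q :: "real poly"
  obtains p where "pderiv p = q"
proof -
  have "pderiv (\<Sum>i\<le>degree q. monom (coeff q i / real (Suc i)) (Suc i)) =
      (\<Sum>i\<le>degree q. monom (coeff q i) i)"
    by (simp add: pderiv_sum pderiv_monom)
  also have "\<dots> = q" by (rule poly_as_sum_of_monoms)
  finally show ?thesis by (rule that)
qed

definition zonal :: "(real ^ 'n::finite) \<times> real \<Rightarrow> real poly \<Rightarrow> real" where
  "zonal u p = sphere_mean (\<lambda>z. poly p (z \<bullet> u))"

lemma continuous_poly_inner [continuous_intros]:
  "continuous_on A f \<Longrightarrow> continuous_on A (\<lambda>z. poly p (f z \<bullet> u))"
  for p :: "real poly"
  by (intro continuous_on_compose2[OF continuous_on_poly[OF continuous_on_id, of UNIV]] continuous_intros) auto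

lemma has_derivative_poly_inner:
  fixes p :: "real poly"
  shows "((\<lambda>z. poly p (z \<bullet> u)) has_derivative (\<lambda>h. poly (pderiv p) (z \<bullet> u) * (h \<bullet> u))) (at z)"
proof -
  have "((\<lambda>z. z \<bullet> u) has_derivative (\<lambda>h. h \<bullet> u)) (at z)"
    by (auto intro!: derivative_eq_intros)
  from DERIV_compose_FDERIV[OF poly_DERIV this] show ?thesis
    by (simp add: mult.commute)
qed

text \<open>Rotation in the plane of \<open>fst u\<close> and the last axis, applied to an
  antiderivative of \<open>p\<close> in the zonal variable.\<close>

lemma zonal_diagonal_rotation:
  "sphere_mean (\<lambda>z. poly p (z \<bullet> u) * (snd z * (fst u \<bullet> fst u) - (fst z \<bullet> fst u) * snd u)) = 0"
proof -
  obtain P where P: "pderiv P = p" by (rule pderiv_surj)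
  show ?thesis
  proof (rule sphere_mean_rotation[where G = "\<lambda>z. poly P (z \<bullet> u)" and e = "fst u",
        OF has_derivative_poly_inner])
    show "poly p (z \<bullet> u) * (snd z * (fst u \<bullet> fst u) - (fst z \<bullet> fst u) * snd u) =
        poly (pderiv P) (z \<bullet> u) * ((snd z *\<^sub>R fst u, - (fst z \<bullet> fst u)) \<bullet> u)" for z
      by (simp add: P inner_prod_def)
  qed (intro continuous_intros)
qed

text \<open>The functions \<open>x_i * g (z \<bullet> u)\<close> are rotated in the planes of axis
  \<open>i\<close> and the last axis, and the identities are summed over \<open>i\<close>. The
  result is the claim multiplied by \<open>snd u\<close>, hence the case distinction.\<close>

lemma zonal_parts_tilted:
  fixes u :: "(real ^ 'n::finite) \<times> real"
  assumes u: "norm u = 1" and b: "snd u \<noteq> 0"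
  shows "zonal u ([:1, 0, -1:] * pderiv g) = real CARD('n) * zonal u ([:0, 1:] * g)"
proof -
  let ?t = "\<lambda>z. z \<bullet> u" and ?b = "snd u" and ?g = "\<lambda>z. poly g (z \<bullet> u)" and ?h = "\<lambda>z. poly (pderiv g) (z \<bullet> u)"
  have aa: "fst u \<bullet> fst u = 1 - ?b\<^sup>2"
    using u unfolding norm_eq_1 inner_prod_def by (simp add: power2_eq_square)
  \<comment> \<open>Against zonal functions, \<open>snd z\<close> may be replaced by its component
    along \<open>u\<close>.\<close>
  have rot: "sphere_mean (\<lambda>z. snd z * poly p (?t z)) = ?b * sphere_mean (\<lambda>z. ?t z * poly p (?t z))" for p
  proof -
    have "sphere_mean (\<lambda>z. poly p (?t z) * (snd z * (fst u \<bullet> fst u) - (fst z \<bullet> fst u) * ?b)) =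
        sphere_mean (\<lambda>z. snd z * poly p (?t z) - ?b * (?t z * poly p (?t z)))"
      by (rule arg_cong[of _ _ sphere_mean]) (simp add: fun_eq_iff aa inner_prod_def algebra_simps power2_eq_square)
    then show ?thesis
      using zonal_diagonal_rotation[of p u]
      by (subst (asm) sphere_mean_diff) (auto intro!: continuous_intros simp: sphere_mean_cmult)
  qed
  have "sphere_mean (\<lambda>z. snd z * ?g z + (fst z $ i) * ?h z * (snd z * (fst u $ i) - (fst z $ i) * ?b)) = 0" (is "sphere_mean (?R i) = 0") for i
  proof (rule sphere_mean_rotation[where e = "axis i 1" and G = "\<lambda>z. (fst z $ i) * ?g z"])
    fix z :: "(real ^ 'n) \<times> real"
    have fi: "((\<lambda>z. fst z $ i) has_derivative (\<lambda>h. fst h $ i)) (at z)"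
      by (intro bounded_linear_imp_has_derivative bounded_linear_compose[OF bounded_linear_vec_nth] bounded_linear_fst)
    show "((\<lambda>z. (fst z $ i) * ?g z) has_derivative (\<lambda>h. fst z $ i * (?h z * (h \<bullet> u)) + (fst h $ i) * ?g z)) (at z)"
      by (rule has_derivative_mult[OF fi has_derivative_poly_inner])
    show "?R i z = fst z $ i * (?h z * ((snd z *\<^sub>R axis i 1, - (fst z \<bullet> axis i 1)) \<bullet> u)) +
        fst (snd z *\<^sub>R axis i 1, - (fst z \<bullet> axis i 1)) $ i * ?g z"
      by (simp add: inner_prod_def inner_axis inner_axis' algebra_simps)
  qed (intro continuous_intros)
  then have "sphere_mean (\<lambda>z. \<Sum>i\<in>UNIV. ?R i z) = 0"
    by (subst sphere_mean_sum) (auto intro!: continuous_intros)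
  \<comment> \<open>The sums over \<open>i\<close> become inner products, and on the sphere
    \<open>fst z \<bullet> fst z = 1 - (snd z)^2\<close>.\<close>
  also have "sphere_mean (\<lambda>z. \<Sum>i\<in>UNIV. ?R i z) =
      sphere_mean (\<lambda>z. real CARD('n) * (snd z * ?g z) + (snd z * poly ([:0, 1:] * pderiv g) (?t z) - ?b * ?h z))"
  proof (rule sphere_mean_cong)
    fix z :: "(real ^ 'n) \<times> real" assume "norm z = 1"
    then have x: "fst z \<bullet> fst z = 1 - (snd z)\<^sup>2"
      unfolding norm_eq_1 inner_prod_def by (simp add: power2_eq_square)
    have "(\<Sum>i\<in>UNIV. ?R i z) = real CARD('n) * (snd z * ?g z) +
        ?h z * (snd z * (\<Sum>i\<in>UNIV. fst z $ i * fst u $ i) - ?b * (\<Sum>i\<in>UNIV. fst z $ i * fst z $ i))"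
      by (simp add: sum.distrib sum_subtractf sum_distrib_left algebra_simps)
    also have "\<dots> = real CARD('n) * (snd z * ?g z) + ?h z * (snd z * (fst z \<bullet> fst u) - ?b * (fst z \<bullet> fst z))"
      by (simp add: inner_vec_def)
    also have "\<dots> = real CARD('n) * (snd z * ?g z) + (snd z * poly ([:0, 1:] * pderiv g) (?t z) - ?b * ?h z)"
      unfolding x by (simp add: inner_prod_def algebra_simps power2_eq_square)
    finally show "(\<Sum>i\<in>UNIV. ?R i z) = \<dots>" .
  qed (intro continuous_intros)+
  also have "\<dots> = real CARD('n) * sphere_mean (\<lambda>z. snd z * ?g z) +
      (sphere_mean (\<lambda>z. snd z * poly ([:0, 1:] * pderiv g) (?t z)) - ?b * sphere_mean ?h)"
    by (subst sphere_mean_add sphere_mean_diff, (intro continuous_intros)+)+ (simp add: sphere_mean_cmult)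
  also have "\<dots> = ?b * (real CARD('n) * zonal u ([:0, 1:] * g) - (sphere_mean ?h - sphere_mean (\<lambda>z. ?t z * (?t z * ?h z))))"
    unfolding rot by (simp add: zonal_def algebra_simps)
  also have "sphere_mean ?h - sphere_mean (\<lambda>z. ?t z * (?t z * ?h z)) = zonal u ([:1, 0, -1:] * pderiv g)"
    unfolding zonal_def
    by (subst sphere_mean_diff[symmetric]) (auto intro!: continuous_intros simp: algebra_simps)
  finally show ?thesis using b by simp
qed

text \<open>For \<open>snd u = 0\<close> the identity of the tilted case degenerates. A further
  factor \<open>snd z\<close> is inserted in the rotated functions, with \<open>pderiv g\<close> in
  place of \<open>g\<close>, and \<open>rot\<close> removes the resulting factor
  \<open>(snd z)^2\<close>. This case occurs when \<open>u\<close> lies above a boundary point of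
  the ball.\<close>

lemma zonal_parts_horizontal:
  fixes u :: "(real ^ 'n::finite) \<times> real"
  assumes u: "norm u = 1" and b: "snd u = 0"
  shows "zonal u ([:1, 0, -1:] * pderiv g) = real CARD('n) * zonal u ([:0, 1:] * g)"
proof -
  let ?t = "\<lambda>z. z \<bullet> u" and ?g = "\<lambda>z. poly g (z \<bullet> u)"
    and ?h = "\<lambda>z. poly (pderiv g) (z \<bullet> u)" and ?k = "\<lambda>z. poly (pderiv (pderiv g)) (z \<bullet> u)"
  have aa: "fst u \<bullet> fst u = 1"
    using u b unfolding norm_eq_1 inner_prod_def by simp
  have t: "fst z \<bullet> fst u = ?t z" for z
    by (simp add: inner_prod_def b)
  have dsnd: "(snd has_derivative snd) (at z)" for z :: "(real ^ 'n) \<times> real"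
    by (intro bounded_linear_imp_has_derivative bounded_linear_snd)
  have rot: "sphere_mean (\<lambda>z. (snd z)\<^sup>2 * poly (pderiv p) (?t z)) = sphere_mean (\<lambda>z. ?t z * poly p (?t z))" for p
  proof -
    have "sphere_mean (\<lambda>z. (snd z)\<^sup>2 * poly (pderiv p) (?t z) - ?t z * poly p (?t z)) = 0"
    proof (rule sphere_mean_rotation[where e = "fst u" and G = "\<lambda>z. snd z * poly p (?t z)"])
      show "((\<lambda>z. snd z * poly p (?t z)) has_derivative
          (\<lambda>h. snd z * (poly (pderiv p) (?t z) * (h \<bullet> u)) + snd h * poly p (?t z))) (at z)" for z
        by (rule has_derivative_mult[OF dsnd has_derivative_poly_inner])
      show "(snd z)\<^sup>2 * poly (pderiv p) (?t z) - ?t z * poly p (?t z) =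
          snd z * (poly (pderiv p) (?t z) * ((snd z *\<^sub>R fst u, - (fst z \<bullet> fst u)) \<bullet> u)) +
          snd (snd z *\<^sub>R fst u, - (fst z \<bullet> fst u)) * poly p (?t z)" for z
        by (simp add: inner_prod_def aa b power2_eq_square)
    qed (intro continuous_intros)
    then show ?thesis
      by (subst (asm) sphere_mean_diff) (auto intro!: continuous_intros)
  qed
  have "sphere_mean (\<lambda>z. (snd z)\<^sup>2 * ?h z + (snd z)\<^sup>2 * (fst z $ i * fst u $ i) * ?k z - (fst z $ i)\<^sup>2 * ?h z) = 0" (is "sphere_mean (?R i) = 0") for i
  proof (rule sphere_mean_rotation[where e = "axis i 1" and G = "\<lambda>z. (fst z $ i * snd z) * ?h z"])
    fix z :: "(real ^ 'n) \<times> real"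
    have fi: "((\<lambda>z. fst z $ i) has_derivative (\<lambda>h. fst h $ i)) (at z)"
      by (intro bounded_linear_imp_has_derivative bounded_linear_compose[OF bounded_linear_vec_nth] bounded_linear_fst)
    show "((\<lambda>z. (fst z $ i * snd z) * ?h z) has_derivative
        (\<lambda>h. (fst z $ i * snd z) * (?k z * (h \<bullet> u)) + (fst z $ i * snd h + fst h $ i * snd z) * ?h z)) (at z)"
      by (rule has_derivative_mult[OF has_derivative_mult[OF fi dsnd] has_derivative_poly_inner])
    show "?R i z = (fst z $ i * snd z) * (?k z * ((snd z *\<^sub>R axis i 1, - (fst z \<bullet> axis i 1)) \<bullet> u)) +
        (fst z $ i * snd (snd z *\<^sub>R axis i 1 :: real ^ 'n, - (fst z \<bullet> axis i 1)) +
         fst (snd z *\<^sub>R axis i 1 :: real ^ 'n, - (fst z \<bullet> axis i 1)) $ i * snd z) * ?h z"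
      by (simp add: inner_prod_def inner_axis inner_axis' b algebra_simps power2_eq_square)
  qed (intro continuous_intros)
  then have "sphere_mean (\<lambda>z. \<Sum>i\<in>UNIV. ?R i z) = 0"
    by (subst sphere_mean_sum) (auto intro!: continuous_intros)
  also have "sphere_mean (\<lambda>z. \<Sum>i\<in>UNIV. ?R i z) =
      sphere_mean (\<lambda>z. real CARD('n) * ((snd z)\<^sup>2 * ?h z) +
        ((snd z)\<^sup>2 * poly (pderiv ([:0, 1:] * pderiv g)) (?t z) - ?h z))"
  proof (rule sphere_mean_cong)
    fix z :: "(real ^ 'n) \<times> real" assume "norm z = 1"
    then have x: "fst z \<bullet> fst z = 1 - (snd z)\<^sup>2"
      unfolding norm_eq_1 inner_prod_def by (simp add: power2_eq_square)
    have "(\<Sum>i\<in>UNIV. ?R i z) = real CARD('n) * ((snd z)\<^sup>2 * ?h z) +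
        (snd z)\<^sup>2 * ?k z * (\<Sum>i\<in>UNIV. fst z $ i * fst u $ i) - ?h z * (\<Sum>i\<in>UNIV. fst z $ i * fst z $ i)"
      by (simp add: sum.distrib sum_subtractf sum_distrib_left algebra_simps power2_eq_square)
    also have "\<dots> = real CARD('n) * ((snd z)\<^sup>2 * ?h z) +
        (snd z)\<^sup>2 * ?k z * (fst z \<bullet> fst u) - ?h z * (fst z \<bullet> fst z)"
      by (simp add: inner_vec_def)
    also have "\<dots> = real CARD('n) * ((snd z)\<^sup>2 * ?h z) +
        ((snd z)\<^sup>2 * poly (pderiv ([:0, 1:] * pderiv g)) (?t z) - ?h z)"
      unfolding x t by (simp add: pderiv_mult pderiv_pCons algebra_simps)
    finally show "(\<Sum>i\<in>UNIV. ?R i z) = \<dots>" .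
  qed (intro continuous_intros)+
  also have "\<dots> = real CARD('n) * sphere_mean (\<lambda>z. (snd z)\<^sup>2 * ?h z) +
      (sphere_mean (\<lambda>z. (snd z)\<^sup>2 * poly (pderiv ([:0, 1:] * pderiv g)) (?t z)) - sphere_mean ?h)"
    by (subst sphere_mean_add sphere_mean_diff, (intro continuous_intros)+)+ (simp add: sphere_mean_cmult)
  also have "\<dots> = real CARD('n) * zonal u ([:0, 1:] * g) - (sphere_mean ?h - sphere_mean (\<lambda>z. ?t z * (?t z * ?h z)))"
    unfolding rot by (simp add: zonal_def algebra_simps)
  also have "sphere_mean ?h - sphere_mean (\<lambda>z. ?t z * (?t z * ?h z)) = zonal u ([:1, 0, -1:] * pderiv g)"
    unfolding zonal_def
    by (subst sphere_mean_diff[symmetric]) (auto intro!: continuous_intros simp: algebra_simps)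
  finally show ?thesis by simp
qed

lemma ultra_functional_zonal:
  fixes u :: "(real ^ 'n::finite) \<times> real"
  assumes "norm u = 1"
  shows "ultra_functional CARD('n) (zonal u)"
proof
  show "CARD('n) \<ge> 1" using zero_less_card_finite[where 'a = 'n] by linarith
  show "zonal u (p + q) = zonal u p + zonal u q" for p q
    unfolding zonal_def poly_add by (intro sphere_mean_add continuous_intros)
  show "zonal u (smult c p) = c * zonal u p" for c p
    unfolding zonal_def poly_smult by (rule sphere_mean_cmult)
  show "zonal u 1 = 1"
    unfolding zonal_def by (simp add: sphere_mean_const)
  show "zonal u ([:1, 0, -1:] * pderiv g) = real CARD('n) * zonal u ([:0, 1:] * g)" for g
    using zonal_parts_tilted[OF assms] zonal_parts_horizontal[OF assms] by blast
qed

section \<open>Polynomials on the ball\<close>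

definition monomial_eval :: "('n::finite \<Rightarrow>\<^sub>0 nat) \<Rightarrow> real ^ 'n \<Rightarrow> real" where
  "monomial_eval m x = (\<Prod>i\<in>UNIV. (x $ i) ^ Poly_Mapping.lookup m i)"

definition monomial_deg :: "('n::finite \<Rightarrow>\<^sub>0 nat) \<Rightarrow> nat" where
  "monomial_deg m = (\<Sum>i\<in>UNIV. Poly_Mapping.lookup m i)"

lemma monomial_eval_plus: "monomial_eval (m + m') x = monomial_eval m x * monomial_eval m' x"
  by (simp add: monomial_eval_def lookup_add power_add prod.distrib)

lemma monomial_deg_plus: "monomial_deg (m + m') = monomial_deg m + monomial_deg m'"
  by (simp add: monomial_deg_def lookup_add sum.distrib)

lemma eval_superset:
  assumes "finite A" "Poly_Mapping.keys p \<subseteq> A"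
  shows "eval p x = (\<Sum>m\<in>A. Poly_Mapping.lookup p m * monomial_eval m x)"
  unfolding eval_def monomial_eval_def[symmetric] using assms
  by (intro sum.mono_neutral_left) (auto simp: in_keys_iff)

lemma eval_0 [simp]: "eval 0 x = 0"
  by (simp add: eval_def)

lemma eval_single: "eval (Poly_Mapping.single m c) x = c * monomial_eval m x"
  using eval_superset[of "{m}" "Poly_Mapping.single m c" x] by simp

lemma eval_add: "eval (p + q) x = eval p x + eval q x"
proof -
  let ?A = "Poly_Mapping.keys p \<union> Poly_Mapping.keys q"
  have "eval (p + q) x = (\<Sum>m\<in>?A. Poly_Mapping.lookup (p + q) m * monomial_eval m x)"
    by (intro eval_superset Poly_Mapping.keys_add) auto
  then show ?thesis
    by (simp add: eval_superset[of ?A p] eval_superset[of ?A q] lookup_add distrib_right sum.distrib)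
qed

lemma eval_sum: "eval (\<Sum>i\<in>A. p i) x = (\<Sum>i\<in>A. eval (p i) x)"
  by (induction A rule: infinite_finite_induct) (auto simp: eval_add)

lemma eval_uminus: "eval (- p) x = - eval p x"
  using eval_add[of p "- p" x] by simp

lemma eval_diff: "eval (p - q) x = eval p x - eval q x"
  using eval_add[of p "- q" x] by (simp add: eval_uminus)

lemma rpoly_eq_sum_single:
  fixes p :: "'a \<Rightarrow>\<^sub>0 'b::comm_monoid_add"
  shows "p = (\<Sum>m\<in>Poly_Mapping.keys p. Poly_Mapping.single m (Poly_Mapping.lookup p m))"
  by (rule poly_mapping_eqI)
     (auto simp: lookup_sum lookup_single when_def in_keys_iff)

lemma rpoly_mult:
  fixes p q :: "'n rpoly"
  shows "p * q = (\<Sum>m\<in>Poly_Mapping.keys p. \<Sum>m'\<in>Poly_Mapping.keys q.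
    Poly_Mapping.single (m + m') (Poly_Mapping.lookup p m * Poly_Mapping.lookup q m'))"
proof -
  have "p * q = (\<Sum>m\<in>Poly_Mapping.keys p. Poly_Mapping.single m (Poly_Mapping.lookup p m)) *
      (\<Sum>m\<in>Poly_Mapping.keys q. Poly_Mapping.single m (Poly_Mapping.lookup q m))"
    using rpoly_eq_sum_single[of p] rpoly_eq_sum_single[of q] by simp
  then show ?thesis by (simp add: sum_product mult_single)
qed

lemma eval_mult: "eval (p * q) x = eval p x * eval q x"
proof -
  have "eval (p * q) x = (\<Sum>m\<in>Poly_Mapping.keys p. \<Sum>m'\<in>Poly_Mapping.keys q.
      (Poly_Mapping.lookup p m * monomial_eval m x) * (Poly_Mapping.lookup q m' * monomial_eval m' x))"
    by (subst rpoly_mult) (simp add: eval_sum eval_single monomial_eval_plus mult_ac)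
  then show ?thesis
    by (simp add: sum_product eval_def monomial_eval_def[symmetric])
qed

definition const_poly :: "real \<Rightarrow> 'n rpoly" where
  "const_poly c = Poly_Mapping.single 0 c"

lemma eval_const [simp]: "eval (const_poly c) x = c"
  by (simp add: const_poly_def eval_single monomial_eval_def)

lemma eval_1 [simp]: "eval 1 x = 1"
  using eval_const[of 1 x] by (simp add: const_poly_def)

lemma eval_var [simp]: "eval (var i) x = x $ i"
proof -
  have "monomial_eval (Poly_Mapping.single i 1) x = (\<Prod>j\<in>UNIV. if j = i then x $ i else 1)"
    unfolding monomial_eval_def by (intro prod.cong) (auto simp: lookup_single when_def)
  then show ?thesis by (simp add: var_def eval_single)
qed

lemma eval_ball_poly: "eval ball_poly x = 1 - (norm x)\<^sup>2"
  by (simp add: ball_poly_def eval_diff eval_sum eval_mult power2_eq_square norm_vec_def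
      L2_set_def sum_nonneg)

lemma continuous_eval [continuous_intros]:
  "continuous_on A g \<Longrightarrow> continuous_on A (\<lambda>z. eval f (g z))"
  unfolding eval_def by (intro continuous_intros)

lemma tdeg_le_iff: "tdeg p \<le> k \<longleftrightarrow> (\<forall>m\<in>Poly_Mapping.keys p. monomial_deg m \<le> k)"
  unfolding tdeg_def monomial_deg_def by (subst Max_le_iff) auto

lemma tdeg_add_le: "tdeg p \<le> k \<Longrightarrow> tdeg q \<le> k \<Longrightarrow> tdeg (p + q) \<le> k"
  unfolding tdeg_le_iff using Poly_Mapping.keys_add[of p q] by blast

lemma tdeg_mult_le:
  assumes "tdeg p \<le> j" "tdeg q \<le> k"
  shows "tdeg (p * q) \<le> j + k"
  unfolding tdeg_le_iff
proof
  fix m assume "m \<in> Poly_Mapping.keys (p * q)"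
  then obtain a b where "m = a + b" "a \<in> Poly_Mapping.keys p" "b \<in> Poly_Mapping.keys q"
    using keys_mult[of p q] by blast
  then show "monomial_deg m \<le> j + k"
    using assms by (auto simp: tdeg_le_iff monomial_deg_plus intro!: add_mono)
qed

lemma tdeg_0 [simp]: "tdeg 0 = 0"
  by (simp add: tdeg_def)

lemma tdeg_sum_le: "(\<And>i. i \<in> A \<Longrightarrow> tdeg (p i) \<le> k) \<Longrightarrow> tdeg (\<Sum>i\<in>A. p i) \<le> k"
  by (induction A rule: infinite_finite_induct) (auto intro: tdeg_add_le)

lemma tdeg_uminus: "tdeg (- p) = tdeg p"
  by (simp add: tdeg_def)

lemma tdeg_const [simp]: "tdeg (const_poly c) = 0"
proof -
  have "tdeg (const_poly c) \<le> 0"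
    unfolding tdeg_le_iff const_poly_def by (auto simp: monomial_deg_def)
  then show ?thesis by simp
qed

lemma tdeg_1 [simp]: "tdeg 1 = 0"
  using tdeg_const[of 1] by (simp add: const_poly_def)

lemma tdeg_var_le: "tdeg (var i) \<le> 1"
  unfolding tdeg_le_iff var_def
  by (auto simp: monomial_deg_def lookup_single when_def)

lemma tdeg_ball_poly_le: "tdeg ball_poly \<le> 2"
proof -
  have "tdeg ((var i)\<^sup>2) \<le> 2" for i :: 'a
    using tdeg_mult_le[OF tdeg_var_le[of i] tdeg_var_le[of i]]
    by (simp only: power2_eq_square one_add_one)
  then have "tdeg (1 + - (\<Sum>i\<in>UNIV. (var i)\<^sup>2) :: 'a rpoly) \<le> 2"
    by (intro tdeg_add_le) (auto simp: tdeg_uminus intro: tdeg_sum_le)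
  then show ?thesis by (simp add: ball_poly_def)
qed

lemma eval_bounded_on_ball: "\<exists>C. \<forall>x\<in>cball 0 1. \<bar>eval f x\<bar> \<le> C"
proof -
  have "bounded (eval f ` cball 0 1)"
    by (intro compact_imp_bounded compact_continuous_image continuous_intros) auto
  then show ?thesis unfolding bounded_iff by auto
qed

section \<open>Extrema and the sup norm on the ball\<close>

lemma ball_min_attained:
  obtains x where "norm x \<le> 1" "eval f x = ball_min f"
proof -
  obtain x where x: "x \<in> cball 0 1" "\<And>y. y \<in> cball 0 1 \<Longrightarrow> eval f x \<le> eval f y"
    using continuous_attains_inf[of "cball 0 1" "eval f"] continuous_eval[OF continuous_on_id, of "cball 0 1" f]
    by auto
  then have "ball_min f = eval f x"
    unfolding ball_min_def by (intro cInf_eq_minimum) auto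
  then show ?thesis using that[of x] x by simp
qed

lemma ball_min_le:
  assumes "norm x \<le> 1" shows "ball_min f \<le> eval f x"
proof -
  obtain C where "\<forall>x\<in>cball 0 1. \<bar>eval f x\<bar> \<le> C" using eval_bounded_on_ball by blast
  then have "bdd_below (eval f ` cball 0 1)"
    by (intro bdd_belowI2[of _ "- C"]) (auto simp: abs_le_iff dest!: bspec)
  then show ?thesis unfolding ball_min_def using assms by (intro cINF_lower) auto
qed

lemma ball_max_ge:
  assumes "norm x \<le> 1" shows "eval f x \<le> ball_max f"
proof -
  obtain C where "\<forall>x\<in>cball 0 1. \<bar>eval f x\<bar> \<le> C" using eval_bounded_on_ball by blast
  then have "bdd_above (eval f ` cball 0 1)"
    by (intro bdd_aboveI2[of _ _ C]) (auto simp: abs_le_iff)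
  then show ?thesis unfolding ball_max_def using assms by (intro cSUP_upper) auto
qed

lemma ball_norm_attained:
  obtains x where "norm x \<le> 1" "\<bar>eval f x\<bar> = ball_norm f"
proof -
  obtain x where x: "x \<in> cball 0 1" "\<And>y. y \<in> cball 0 1 \<Longrightarrow> \<bar>eval f y\<bar> \<le> \<bar>eval f x\<bar>"
    using continuous_attains_sup[of "cball 0 1" "\<lambda>x. \<bar>eval f x\<bar>"]
      continuous_on_rabs[OF continuous_eval[OF continuous_on_id, of "cball 0 1" f]]
    by auto
  then have "ball_norm f = \<bar>eval f x\<bar>"
    unfolding ball_norm_def by (intro cSup_eq_maximum) auto
  then show ?thesis using that[of x] x by simp
qed

lemma ball_norm_ge:
  assumes "norm x \<le> 1" shows "\<bar>eval f x\<bar> \<le> ball_norm f"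
proof -
  obtain C where "\<forall>x\<in>cball 0 1. \<bar>eval f x\<bar> \<le> C" using eval_bounded_on_ball by blast
  then have "bdd_above ((\<lambda>x. \<bar>eval f x\<bar>) ` cball 0 1)"
    by (intro bdd_aboveI2[of _ _ C]) auto
  then show ?thesis unfolding ball_norm_def using assms by (intro cSUP_upper) auto
qed

lemma ball_norm_nonneg: "0 \<le> ball_norm f"
  using ball_norm_ge[of 0 f] by (simp add: order.trans[OF abs_ge_zero])

section \<open>Growth along great circles\<close>

lemma trig_poly_eval_circle:
  assumes "tdeg f \<le> d"
  shows "trig_poly d (\<lambda>\<theta>. eval f (cos \<theta> *\<^sub>R a + sin \<theta> *\<^sub>R b))"
proof -
  have "trig_poly d (\<lambda>\<theta>. \<Sum>m\<in>Poly_Mapping.keys f. Poly_Mapping.lookup f m *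
      (\<Prod>i\<in>UNIV. (a $ i * cos \<theta> + b $ i * sin \<theta>) ^ Poly_Mapping.lookup m i))"
  proof (rule trig_poly_sum_set)
    fix m assume m: "m \<in> Poly_Mapping.keys f"
    have "trig_poly (\<Sum>i\<in>UNIV. Poly_Mapping.lookup m i * 1)
        (\<lambda>\<theta>. \<Prod>i\<in>UNIV. (a $ i * cos \<theta> + b $ i * sin \<theta>) ^ Poly_Mapping.lookup m i)"
      by (intro trig_poly_prod trig_poly_power trig_poly_linear) auto
    from trig_poly_mult[OF trig_poly_const[of "Poly_Mapping.lookup f m"] this]
    show "trig_poly d (\<lambda>\<theta>. Poly_Mapping.lookup f m *
        (\<Prod>i\<in>UNIV. (a $ i * cos \<theta> + b $ i * sin \<theta>) ^ Poly_Mapping.lookup m i))"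
      using m assms by (intro trig_poly_mono[of _ _ d]) (auto simp: tdeg_le_iff monomial_deg_def)
  qed auto
  then show ?thesis by (simp add: eval_def mult.commute)
qed

text \<open>On the great circle through \<open>u\<close> and \<open>z\<close>, parametrized from
  \<open>u\<close>, the function is a trigonometric polynomial of degree \<open>d\<close> with
  minimum \<open>m\<close> at angle 0; \<open>z\<close> sits at the angle whose cosine is
  \<open>z \<bullet> u\<close>.\<close>

lemma sphere_growth:
  fixes f :: "'n::finite rpoly" and u z :: "(real ^ 'n) \<times> real"
  assumes d: "d \<ge> 1" "tdeg f \<le> d" and u: "norm u = 1" and z: "norm z = 1"
    and lo: "\<And>x. norm x \<le> 1 \<Longrightarrow> m \<le> eval f x" and hi: "\<And>x. norm x \<le> 1 \<Longrightarrow> eval f x \<le> m + M"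
    and m: "eval f (fst u) = m"
  shows "eval f (fst z) \<le> m + M / 2 * real d ^ 3 * (1 - z \<bullet> u)"
proof -
  let ?t = "z \<bullet> u"
  have M: "M \<ge> 0" using lo[of 0] hi[of 0] by simp
  have t: "\<bar>?t\<bar> \<le> 1" using Cauchy_Schwarz_ineq2[of z u] u z by simp
  have uu: "u \<bullet> u = 1" and zz: "z \<bullet> z = 1" using u z by (simp_all add: norm_eq_1)
  have fst_le: "norm (fst w) \<le> 1" if "norm w = 1" for w :: "(real ^ 'n) \<times> real"
    using norm_fst_le[of "fst w" "snd w"] that by simp
  consider "?t = 1" | "?t = - 1" | "\<bar>?t\<bar> < 1" using t by linarith
  then show ?thesis
  proof cases
    case 1
    then have "(z - u) \<bullet> (z - u) = 0"
      by (simp add: inner_diff_left inner_diff_right uu zz inner_commute)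
    then show ?thesis using 1 m by simp
  next
    case 2
    \<comment> \<open>At the antipode the great circle is not determined, but there
      \<open>1 - z \<bullet> u = 2\<close> and the trivial bound \<open>M\<close> suffices.\<close>
    have "M * 1 \<le> M * real d ^ 3"
      using d M by (intro mult_left_mono) (auto simp: one_le_power)
    then show ?thesis using 2 hi[OF fst_le[OF z]] by simp
  next
    case 3
    define \<theta> where "\<theta> = arccos ?t"
    have \<theta>: "0 \<le> \<theta>" "\<theta> \<le> pi" "cos \<theta> = ?t"
      using t by (auto simp: \<theta>_def arccos_lbound arccos_ubound cos_arccos abs_le_iff)
    have sin2: "(sin \<theta>)\<^sup>2 = 1 - ?t\<^sup>2" using sin_squared_eq[of \<theta>] \<theta> by simp
    have "?t\<^sup>2 < 1" using 3 by (simp add: abs_square_less_1)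
    then have s: "sin \<theta> \<noteq> 0" using sin2 by auto
    \<comment> \<open>The unit tangent vector at \<open>u\<close> pointing towards
      \<open>z\<close>.\<close>
    define v where "v = (1 / sin \<theta>) *\<^sub>R (z - ?t *\<^sub>R u)"
    have zv: "z = cos \<theta> *\<^sub>R u + sin \<theta> *\<^sub>R v" using s \<theta> by (simp add: v_def)
    have uv: "u \<bullet> v = 0"
      by (simp add: v_def inner_diff_right uu inner_commute)
    have vv: "v \<bullet> v = 1"
    proof -
      have "(z - ?t *\<^sub>R u) \<bullet> (z - ?t *\<^sub>R u) = (sin \<theta>)\<^sup>2"
        unfolding sin2 by (simp add: inner_diff_left inner_diff_right uu zz inner_commute power2_eq_square)
      then show ?thesis using s by (simp add: v_def power2_eq_square)
    qed
    define T where "T = (\<lambda>\<phi>. eval f (cos \<phi> *\<^sub>R fst u + sin \<phi> *\<^sub>R fst v) - m)"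
    have "norm (cos \<phi> *\<^sub>R u + sin \<phi> *\<^sub>R v) = 1" for \<phi>
      unfolding norm_eq_1 using sin_cos_squared_add2[of \<phi>]
      by (simp add: inner_add_left inner_add_right uu vv uv inner_commute power2_eq_square)
    then have circle: "norm (cos \<phi> *\<^sub>R fst u + sin \<phi> *\<^sub>R fst v) \<le> 1" for \<phi>
      using fst_le[of "cos \<phi> *\<^sub>R u + sin \<phi> *\<^sub>R v"] by simp
    have "trig_poly d T"
      using trig_poly_add[OF trig_poly_eval_circle[OF d(2), of "fst u" "fst v"]
          trig_poly_mono[OF trig_poly_const[of "- m"], of d]] by (simp add: T_def)
    then obtain w where w: "\<And>\<phi>. complex_of_real (T \<phi>) = trig_sum d w \<phi>"
      by (rule trig_poly_sum) blast
    have "T \<theta> \<le> M / 2 * real d ^ 3 * (1 - cos \<theta>)"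
      using lo[OF circle] hi[OF circle] m
      by (intro trig_sum_growth[OF d(1) w _ _ _ \<theta>(1,2)]) (auto simp: T_def algebra_simps)
    moreover have "cos \<theta> *\<^sub>R fst u + sin \<theta> *\<^sub>R fst v = fst z"
      using arg_cong[OF zv, of fst] by simp
    ultimately show ?thesis using \<theta> by (simp add: T_def)
  qed
qed

section \<open>Zonal squares as members of the truncated preordering\<close>

definition linear_poly :: "real ^ 'n::finite \<Rightarrow> 'n rpoly" where
  "linear_poly a = (\<Sum>i\<in>UNIV. const_poly (a $ i) * var i)"

lemma eval_linear_poly [simp]: "eval (linear_poly a) x = x \<bullet> a"
  by (simp add: linear_poly_def eval_sum eval_mult inner_vec_def mult.commute)

lemma tdeg_linear_poly_le: "tdeg (linear_poly a) \<le> 1"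
  unfolding linear_poly_def
proof (rule tdeg_sum_le)
  show "tdeg (const_poly (a $ i) * var i) \<le> 1" for i
    using tdeg_mult_le[OF order_refl tdeg_var_le, of "const_poly (a $ i)" i] by simp
qed

text \<open>A polynomial in \<open>(x, s)\<close> reduced modulo \<open>s\<^sup>2 = 1 - \<parallel>x\<parallel>\<^sup>2\<close>.\<close>

lemma zonal_poly_split:
  fixes u :: "(real ^ 'n::finite) \<times> real"
  assumes "degree p \<le> k"
  shows "\<exists>A B. tdeg A \<le> k \<and> tdeg B \<le> k - 1 \<and> (k = 0 \<longrightarrow> B = 0) \<and>
    (\<forall>z. norm z = 1 \<longrightarrow> poly p (z \<bullet> u) = eval A (fst z) + snd z * eval B (fst z))"
  using assms
proof (induction k arbitrary: p)
  case 0
  then obtain c where "p = [:c:]" by (auto elim!: degree_eq_zeroE)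
  then show ?case
    by (intro exI[of _ "const_poly c"] exI[of _ 0]) auto
next
  case (Suc k)
  obtain c q where p: "p = pCons c q" by (cases p)
  then have "degree q \<le> k" using Suc.prems by (auto split: if_splits)
  from Suc.IH[OF this] obtain A B where AB: "tdeg A \<le> k" "tdeg B \<le> k - 1" "k = 0 \<longrightarrow> B = 0"
    "\<And>z. norm z = 1 \<Longrightarrow> poly q (z \<bullet> u) = eval A (fst z) + snd z * eval B (fst z)"
    by blast
  let ?y = "linear_poly (fst u)" and ?b = "const_poly (snd u)"
  \<comment> \<open>A Horner step: \<open>A + s * B\<close> is multiplied by
    \<open>z \<bullet> u\<close>, a linear form in \<open>x\<close> plus a multiple of
    \<open>s\<close>, and \<open>s^2\<close> is replaced by \<open>ball_poly\<close>.
    \<open>A'\<close> collects the terms even in \<open>s\<close>, \<open>B'\<close> the odd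
    ones.\<close>
  define A' where "A' = const_poly c + (?y * A + ?b * (ball_poly * B))"
  define B' where "B' = ?y * B + ?b * A"
  have "tdeg (?y * A) \<le> Suc k"
    using tdeg_mult_le[OF tdeg_linear_poly_le AB(1), of "fst u"] by simp
  moreover have "tdeg (?b * (ball_poly * B)) \<le> Suc k"
  \<comment> \<open>Here \<open>k - 1\<close> truncates to 0 and the degree bound alone is too weak;
    the clause \<open>B = 0\<close> is what helps.\<close>
  proof (cases "k = 0")
    case False
    have "tdeg (?b * (ball_poly * B)) \<le> 0 + (2 + (k - 1))"
      by (intro tdeg_mult_le tdeg_ball_poly_le AB(2)) simp
    then show ?thesis using False by simp
  qed (use AB in auto)
  ultimately have "tdeg A' \<le> Suc k"
    unfolding A'_def by (intro tdeg_add_le) auto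
  moreover have "tdeg B' \<le> Suc k - 1"
  proof -
    have "tdeg (?y * B) \<le> k"
    proof (cases "k = 0")
      case False
      then show ?thesis using tdeg_mult_le[OF tdeg_linear_poly_le AB(2), of "fst u"] by simp
    qed (use AB in auto)
    moreover have "tdeg (?b * A) \<le> k"
      using tdeg_mult_le[OF order_refl AB(1), of ?b] by simp
    ultimately show ?thesis unfolding B'_def by (simp add: tdeg_add_le)
  qed
  moreover have "poly p (z \<bullet> u) = eval A' (fst z) + snd z * eval B' (fst z)" if "norm z = 1" for z
  proof -
    have "(norm (fst z))\<^sup>2 = 1 - (snd z)\<^sup>2"
      using that unfolding norm_eq_1 inner_prod_def power2_norm_eq_inner by (simp add: power2_eq_square)
    then have "eval ball_poly (fst z) = (snd z)\<^sup>2"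
      by (simp add: eval_ball_poly)
    then show ?thesis
      unfolding p poly_pCons AB(4)[OF that] A'_def B'_def
      by (simp add: eval_add eval_mult inner_prod_def algebra_simps power2_eq_square)
  qed
  ultimately show ?case by blast
qed

text \<open>Write \<open>p (z \<bullet> u)\<close> as \<open>A + s * B\<close>. Averaging the
  squares at \<open>s\<close> and \<open>-s\<close> cancels the cross term and leaves
  \<open>A^2 + s^2 * B^2\<close>, where \<open>s^2\<close> is \<open>ball_poly\<close> on the
  ball.\<close>

lemma zonal_square_in_preordering:
  fixes u :: "(real ^ 'n::finite) \<times> real"
  assumes p: "degree p \<le> r" and r: "r \<ge> 1"
  obtains q :: "'n rpoly" where "q \<in> ball_preordering (2 * r)"
    "\<And>x. norm x \<le> 1 \<Longrightarrow>
      eval q x = (poly (p\<^sup>2) ((x, height x) \<bullet> u) + poly (p\<^sup>2) ((x, - height x) \<bullet> u)) / 2"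
proof -
  obtain A B where AB: "tdeg A \<le> r" "tdeg B \<le> r - 1"
    "\<And>z. norm z = 1 \<Longrightarrow> poly p (z \<bullet> u) = eval A (fst z) + snd z * eval B (fst z)"
    using zonal_poly_split[OF p, of u] by blast
  have sos: "C\<^sup>2 \<in> sos" for C :: "'n rpoly"
    unfolding sos_def by (intro CollectI exI[of _ "1::nat"] exI[of _ "\<lambda>_. C"]) simp
  have "tdeg (A\<^sup>2) \<le> 2 * r"
    using tdeg_mult_le[OF AB(1) AB(1)] by (simp only: power2_eq_square mult_2)
  moreover have "tdeg (B\<^sup>2 * ball_poly) \<le> 2 * r"
  proof -
    have "tdeg (B * B * ball_poly) \<le> (r - 1) + (r - 1) + 2"
      by (intro tdeg_mult_le AB(2) tdeg_ball_poly_le)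
    then show ?thesis using r by (simp add: power2_eq_square)
  qed
  ultimately have "A\<^sup>2 + B\<^sup>2 * ball_poly \<in> ball_preordering (2 * r)"
    unfolding ball_preordering_def using sos by blast
  moreover have "eval (A\<^sup>2 + B\<^sup>2 * ball_poly) x =
      (poly (p\<^sup>2) ((x, height x) \<bullet> u) + poly (p\<^sup>2) ((x, - height x) \<bullet> u)) / 2" if "norm x \<le> 1" for x
  proof -
    have "eval (A\<^sup>2 + B\<^sup>2 * ball_poly) x = (eval A x)\<^sup>2 + (eval B x)\<^sup>2 * (height x)\<^sup>2"
      using height_square[OF that] by (simp add: eval_add eval_mult eval_ball_poly power2_eq_square)
    moreover have "poly p ((x, height x) \<bullet> u) = eval A x + height x * eval B x"
      "poly p ((x, - height x) \<bullet> u) = eval A x - height x * eval B x"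
      using AB(3)[OF norm_height(1)[OF that]] AB(3)[OF norm_height(2)[OF that]] by simp_all
    ultimately show ?thesis
      by (simp only: poly_power) (simp add: power2_eq_square algebra_simps)
  qed
  ultimately show ?thesis by (rule that)
qed

lemma integral_zonal:
  fixes u :: "(real ^ 'n::finite) \<times> real"
  assumes "\<And>x. norm x \<le> 1 \<Longrightarrow>
      eval q x = (poly Q ((x, height x) \<bullet> u) + poly Q ((x, - height x) \<bullet> u)) / 2"
  shows "(\<integral>x. eval f x * eval q x \<partial>ball_measure) = sphere_mean (\<lambda>z. eval f (fst z) * poly Q (z \<bullet> u))"
  unfolding sphere_mean_def
proof (rule integral_ball_cong)
  show "continuous_on UNIV (\<lambda>x. (eval f (fst (x, height x)) * poly Q ((x, height x) \<bullet> u) +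
      eval f (fst (x, - height x)) * poly Q ((x, - height x) \<bullet> u)) / 2)"
    by (rule continuous_sphere_integrand) (intro continuous_intros)
qed (auto intro!: continuous_intros simp: assms algebra_simps add_divide_distrib)

section \<open>The upper bound and the constant \<open>\<gamma>\<close>\<close>

lemma eval_sos_nonneg: "s \<in> sos \<Longrightarrow> eval s x \<ge> 0"
  by (auto simp: sos_def eval_sum power2_eq_square eval_mult intro!: sum_nonneg)

lemma preordering_nonneg:
  assumes "q \<in> ball_preordering k" "norm x \<le> 1"
  shows "eval q x \<ge> 0"
proof -
  obtain s0 s1 where q: "q = s0 + s1 * ball_poly" and "s0 \<in> sos" "s1 \<in> sos"
    using assms(1) by (auto simp: ball_preordering_def)
  then show ?thesis
    using assms(2) eval_sos_nonneg[of s0 x] eval_sos_nonneg[of s1 x]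
    unfolding q eval_add eval_mult eval_ball_poly
    by (intro add_nonneg_nonneg mult_nonneg_nonneg) (auto simp: abs_square_le_1)
qed

text \<open>Members of the preordering are nonnegative on the ball, so with total mass 1 every
  competitor is at least the minimum of \<open>f\<close>; this makes the infimum a genuine lower
  bound.\<close>

lemma ub_le:
  fixes f :: "'n::finite rpoly"
  assumes "q \<in> ball_preordering (2 * r)" "(\<integral>x. eval q x \<partial>ball_measure) = 1"
  shows "ub f r \<le> (\<integral>x. eval f x * eval q x \<partial>ball_measure)"
  unfolding ub_def
proof (rule cInf_lower)
  show "bdd_below {\<integral>x. eval f x * eval q x \<partial>ball_measure | q.
      q \<in> ball_preordering (2 * r) \<and> (\<integral>x. eval q x \<partial>ball_measure) = 1}"
  proof (rule bdd_belowI, clarify)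
    fix q :: "'n rpoly"
    assume q: "q \<in> ball_preordering (2 * r)" "(\<integral>x. eval q x \<partial>ball_measure) = 1"
    have "(\<integral>x. ball_min f * eval q x \<partial>ball_measure) \<le> (\<integral>x. eval f x * eval q x \<partial>ball_measure)"
      by (intro integral_ball_mono continuous_intros mult_right_mono ball_min_le preordering_nonneg[OF q(1)]) auto
    then show "ball_min f \<le> (\<integral>x. eval f x * eval q x \<partial>ball_measure)"
      using q(2) by simp
  qed
qed (use assms in auto)

lemma ub_minus_min_le:
  fixes f :: "'n::finite rpoly"
  assumes d: "d \<ge> 1" "tdeg f \<le> d" and r: "r \<ge> 1"
  shows "ub f r - ball_min f \<le> (real CARD('n))\<^sup>2 * real d ^ 3 / (real r)\<^sup>2 * (ball_max f - ball_min f)"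
proof -
  let ?m = "ball_min f" and ?M = "ball_max f - ball_min f"
  obtain a where a: "norm a \<le> 1" "eval f a = ?m" by (rule ball_min_attained)
  define u where "u = (a, height a)"
  have u: "norm u = 1" using norm_height(1)[OF a(1)] by (simp add: u_def)
  interpret ultra_functional "CARD('n)" "zonal u" by (rule ultra_functional_zonal[OF u])
  obtain p where p: "degree p \<le> r" "zonal u (p\<^sup>2) = 1"
      "(real r)\<^sup>2 * zonal u ([:1, -1:] * p\<^sup>2) \<le> 2 * (real CARD('n))\<^sup>2"
    using exists_concentrated_poly[OF n, of r] ultra_functional_axioms by blast
  obtain q :: "'n rpoly" where q: "q \<in> ball_preordering (2 * r)"
    "\<And>x. norm x \<le> 1 \<Longrightarrow>
      eval q x = (poly (p\<^sup>2) ((x, height x) \<bullet> u) + poly (p\<^sup>2) ((x, - height x) \<bullet> u)) / 2"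
    using zonal_square_in_preordering[OF p(1) r, of u] by blast
  have M: "?M \<ge> 0" using ball_min_le[of 0 f] ball_max_ge[of 0 f] by simp
  have "(\<integral>x. eval q x \<partial>ball_measure) = 1"
    using integral_zonal[OF q(2), of 1] p(2) by (simp add: zonal_def)
  then have "ub f r \<le> (\<integral>x. eval f x * eval q x \<partial>ball_measure)"
    by (rule ub_le[OF q(1)])
  also have "\<dots> = sphere_mean (\<lambda>z. eval f (fst z) * poly (p\<^sup>2) (z \<bullet> u))"
    by (rule integral_zonal[OF q(2)])
  also have "\<dots> \<le> sphere_mean (\<lambda>z. ?m * poly (p\<^sup>2) (z \<bullet> u) +
      (?M / 2 * real d ^ 3) * poly ([:1, -1:] * p\<^sup>2) (z \<bullet> u))"
  proof (rule sphere_mean_mono)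
    fix z :: "(real ^ 'n) \<times> real" assume z: "norm z = 1"
    have "eval f (fst z) \<le> ?m + ?M / 2 * real d ^ 3 * (1 - z \<bullet> u)"
      using ball_min_le ball_max_ge a(2)
      by (intro sphere_growth[OF d u z]) (auto simp: u_def)
    then have "eval f (fst z) * poly (p\<^sup>2) (z \<bullet> u) \<le> (?m + ?M / 2 * real d ^ 3 * (1 - z \<bullet> u)) * poly (p\<^sup>2) (z \<bullet> u)"
      by (rule mult_right_mono) (simp add: poly_power)
    then show "eval f (fst z) * poly (p\<^sup>2) (z \<bullet> u) \<le> ?m * poly (p\<^sup>2) (z \<bullet> u) +
        (?M / 2 * real d ^ 3) * poly ([:1, -1:] * p\<^sup>2) (z \<bullet> u)"
      by (simp add: algebra_simps)
  qed (intro continuous_intros)+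
  also have "\<dots> = ?m * zonal u (p\<^sup>2) + ?M / 2 * real d ^ 3 * zonal u ([:1, -1:] * p\<^sup>2)"
    unfolding zonal_def by (subst sphere_mean_add) ((intro continuous_intros)+, simp only: sphere_mean_cmult)
  \<comment> \<open>The 1/2 of the growth estimate cancels the 2 of the concentration bound.\<close>
  also have "\<dots> \<le> ?m + ?M / 2 * real d ^ 3 * (2 * (real CARD('n))\<^sup>2 / (real r)\<^sup>2)"
  proof (intro add_mono mult_left_mono)
    show "zonal u ([:1, -1:] * p\<^sup>2) \<le> 2 * (real CARD('n))\<^sup>2 / (real r)\<^sup>2"
      using p(3) r by (simp add: pos_le_divide_eq mult.commute del: mult_pCons_left)
  qed (use p(2) M in auto)
  finally show ?thesis by (simp add: mult_ac)
qed

text \<open>Around a point where \<open>p\<close> attains its sup norm, the growth estimate keeps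
  \<open>p\<close> comparable to that norm in a neighbourhood depending only on \<open>d\<close> and
  the dimension. A fixed density concentrated there compares the norm with the mean square.\<close>

lemma norm_equivalence:
  assumes d: "d \<ge> 1"
  shows "\<exists>C\<ge>0. \<forall>p::'n::finite rpoly. tdeg p \<le> d \<longrightarrow> (ball_norm p)\<^sup>2 \<le> C * ball_inner p p"
proof -
  \<comment> \<open>With this \<open>r\<close> the mean of \<open>1 - z \<bullet> u\<close> under
    the test density is at most \<open>1 / (2 * d^4)\<close>, so the growth term costs at most half
    of the norm.\<close>
  define r where "r = 2 * CARD('n) * d\<^sup>2"
  have "CARD('n) \<ge> 1" using zero_less_card_finite[where 'a = 'n] by linarith
  from exists_concentrated_poly[OF this, of r] obtain q where
    q: "\<And>l. ultra_functional CARD('n) l \<Longrightarrow>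
      l (q\<^sup>2) = 1 \<and> (real r)\<^sup>2 * l ([:1, -1:] * q\<^sup>2) \<le> 2 * (real CARD('n))\<^sup>2"
    by blast
  have "bounded (poly (q ^ 4) ` {-1..1})"
    by (intro compact_imp_bounded compact_continuous_image continuous_intros) auto
  then obtain K where K: "K > 0" "\<And>t. \<bar>t\<bar> \<le> 1 \<Longrightarrow> poly (q ^ 4) t \<le> K"
    unfolding bounded_pos by (force simp: abs_le_iff)
  show ?thesis
  proof (intro exI[of _ "4 * K"] conjI allI impI)
    fix p :: "'n rpoly" assume p: "tdeg p \<le> d"
    let ?N = "ball_norm p"
    have inner: "ball_inner p p = sphere_mean (\<lambda>z. (eval p (fst z))\<^sup>2)"
      unfolding ball_inner_def sphere_mean_def by (simp add: power2_eq_square)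
    show "?N\<^sup>2 \<le> 4 * K * ball_inner p p"
    proof (cases "?N = 0")
      case True
      have "ball_inner p p \<ge> 0" unfolding ball_inner_def by simp
      then show ?thesis using True K by simp
    next
      case False
      then have N: "?N > 0" using ball_norm_nonneg[of p] by simp
      obtain a where a: "norm a \<le> 1" "\<bar>eval p a\<bar> = ?N" by (rule ball_norm_attained)
      \<comment> \<open>The sign that makes the extremal value of \<open>F\<close> at
        \<open>a\<close> its minimum.\<close>
      define c where "c = (if eval p a \<le> 0 then 1 else - 1 :: real)"
      have c: "c\<^sup>2 = 1" "c * eval p a = - ?N" "\<bar>c\<bar> = 1" using a(2) by (auto simp: c_def)
      define F where "F = const_poly c * p"
      have F: "eval F x = c * eval p x" for x by (simp add: F_def eval_mult)
      have "tdeg F \<le> d" using tdeg_mult_le[OF order_refl p, of "const_poly c"] by (simp add: F_def)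
      define u where "u = (a, height a)"
      have u: "norm u = 1" using norm_height(1)[OF a(1)] by (simp add: u_def)
      note q = q[OF ultra_functional_zonal[OF u]]
      have range: "\<bar>eval F x\<bar> \<le> ?N" if "norm x \<le> 1" for x
        using ball_norm_ge[OF that, of p] by (simp add: F abs_mult c)
      have growth: "eval F (fst z) \<le> - ?N + (2 * ?N) / 2 * real d ^ 3 * (1 - z \<bullet> u)" if "norm z = 1" for z
      proof (rule sphere_growth[OF d \<open>tdeg F \<le> d\<close> u that])
        show "- ?N \<le> eval F x" if "norm x \<le> 1" for x
          using range[OF that] by linarith
        show "eval F x \<le> - ?N + 2 * ?N" if "norm x \<le> 1" for x
          using range[OF that] by linarith
      qed (use c in \<open>simp add: F u_def\<close>)
      have "?N * poly (q\<^sup>2) (z \<bullet> u) - (?N * real d ^ 3) * poly ([:1, -1:] * q\<^sup>2) (z \<bullet> u)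
          \<le> (K / ?N) * (eval p (fst z))\<^sup>2 + ?N / 4" (is "_ \<le> ?R z") if z: "norm z = 1" for z
      proof -
        let ?Q = "poly (q\<^sup>2) (z \<bullet> u)" and ?F = "eval F (fst z)"
        have t: "\<bar>z \<bullet> u\<bar> \<le> 1" using Cauchy_Schwarz_ineq2[of z u] u z by simp
        have "(?N + - ?N * real d ^ 3 * (1 - z \<bullet> u)) * ?Q \<le> - ?F * ?Q"
          using growth[OF z] by (intro mult_right_mono) (auto simp: poly_power)
        also have "\<dots> \<le> (K / ?N) * ?F\<^sup>2 + ?N / (4 * K) * ?Q\<^sup>2"
        proof -
          \<comment> \<open>Weighted arithmetic-geometric mean inequality; the weights make the
            \<open>?Q\<close> term at most \<open>?N / 4\<close>, half of what the growth estimate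
            leaves.\<close>
          have "0 \<le> (2 * K * ?F + ?N * ?Q)\<^sup>2 / (4 * K * ?N)" using K N by simp
          also have "\<dots> = (K / ?N) * ?F\<^sup>2 + ?N / (4 * K) * ?Q\<^sup>2 + ?F * ?Q"
            using K N by (simp add: field_simps power2_eq_square)
          finally show ?thesis by simp
        qed
        also have "?Q\<^sup>2 \<le> K" using K(2)[OF t] by (simp add: poly_power flip: power_mult)
        then have "?N / (4 * K) * ?Q\<^sup>2 \<le> ?N / (4 * K) * K"
          using K N by (intro mult_left_mono) auto
        also have "?N / (4 * K) * K = ?N / 4" using K by simp
        also have "?F\<^sup>2 = (eval p (fst z))\<^sup>2" by (simp add: F power_mult_distrib c)
        finally show ?thesis by (simp add: algebra_simps)
      qed
      then have "sphere_mean (\<lambda>z. ?N * poly (q\<^sup>2) (z \<bullet> u) - (?N * real d ^ 3) * poly ([:1, -1:] * q\<^sup>2) (z \<bullet> u))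
          \<le> sphere_mean ?R"
        by (intro sphere_mean_mono continuous_intros) auto
      also have "sphere_mean ?R = K / ?N * ball_inner p p + ?N / 4"
        unfolding inner
        by (subst sphere_mean_add) (auto intro!: continuous_intros simp: sphere_mean_cmult sphere_mean_const
            simp del: times_divide_eq_left)
      also have "sphere_mean (\<lambda>z. ?N * poly (q\<^sup>2) (z \<bullet> u) - (?N * real d ^ 3) * poly ([:1, -1:] * q\<^sup>2) (z \<bullet> u)) =
          ?N * zonal u (q\<^sup>2) - ?N * real d ^ 3 * zonal u ([:1, -1:] * q\<^sup>2)"
        unfolding zonal_def by (subst sphere_mean_diff) ((intro continuous_intros)+, simp only: sphere_mean_cmult)
      also have "\<dots> \<ge> ?N - ?N / 2"
      proof -
        define Z where "Z = zonal u ([:1, -1:] * q\<^sup>2)"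
        have Z: "(2 * real CARD('n) * (real d)\<^sup>2)\<^sup>2 * Z \<le> 2 * (real CARD('n))\<^sup>2"
          using q by (simp add: Z_def r_def del: mult_pCons_left)
        have "real d ^ 3 * Z \<le> 1 / 2"
        proof (cases "Z \<le> 0")
          case True
          then have "real d ^ 3 * Z \<le> 0" by (simp add: mult_nonneg_nonpos)
          then show ?thesis by simp
        next
          case False
          have "real d ^ 3 * Z \<le> real d ^ 4 * Z"
            using d False by (intro mult_right_mono power_increasing) auto
          also have "(2 * (real CARD('n))\<^sup>2) * (2 * (real d ^ 4 * Z)) \<le> (2 * (real CARD('n))\<^sup>2) * 1"
            using Z by (simp add: power_mult_distrib mult_ac flip: power_mult)
          then have "2 * (real d ^ 4 * Z) \<le> 1"
            by (rule mult_left_le_imp_le) simp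
          then have "real d ^ 4 * Z \<le> 1 / 2" by simp
          finally show ?thesis .
        qed
        then have "?N * (real d ^ 3 * Z) \<le> ?N * (1 / 2)"
          using N by (intro mult_left_mono) auto
        then show ?thesis using q by (simp add: Z_def mult.assoc del: mult_pCons_left)
      qed
      finally have "?N / 4 \<le> K / ?N * ball_inner p p" by linarith
      then have "?N * (?N / 4) \<le> ?N * (K / ?N * ball_inner p p)"
        using N by (intro mult_left_mono) auto
      then show ?thesis using N by (simp add: power2_eq_square)
    qed
  qed (use K in simp)
qed

section \<open>Orthogonal components and the lower bound for gamma\<close>

lemma ball_inner_commute: "ball_inner p q = ball_inner q p"
  by (simp add: ball_inner_def mult.commute)

lemma integrable_eval_mult: "integrable ball_measure (\<lambda>x. eval p x * eval q x)"
  by (intro integrable_ball continuous_intros)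

lemma ball_inner_add_left: "ball_inner (p + q) s = ball_inner p s + ball_inner q s"
  by (simp add: ball_inner_def eval_add distrib_right integrable_eval_mult)

lemma ball_inner_0_left: "ball_inner 0 s = 0"
  by (simp add: ball_inner_def)

lemma ball_inner_sum_left: "ball_inner (\<Sum>i\<in>A. p i) s = (\<Sum>i\<in>A. ball_inner (p i) s)"
  by (induction A rule: infinite_finite_induct) (auto simp: ball_inner_add_left ball_inner_0_left)

lemma ball_inner_self_nonneg: "ball_inner p p \<ge> 0"
  by (simp add: ball_inner_def)

lemma ball_inner_self_le: "ball_inner p p \<le> (ball_norm p)\<^sup>2" for p :: "'n::finite rpoly"
proof -
  have "ball_inner p p \<le> (\<integral>x. (ball_norm p)\<^sup>2 \<partial>(ball_measure :: (real ^ 'n) measure))"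
    unfolding ball_inner_def
  proof (intro integral_ball_mono continuous_intros)
    fix x :: "real ^ 'n" assume "norm x \<le> 1"
    then have "\<bar>eval p x\<bar> ^ 2 \<le> (ball_norm p)\<^sup>2"
      by (intro power_mono ball_norm_ge) auto
    then show "eval p x * eval p x \<le> (ball_norm p)\<^sup>2" by (simp add: power2_eq_square)
  qed
  then show ?thesis by (simp add: measure_ball_measure)
qed

text \<open>Pythagoras: a component of lower index has degree below that of the higher one, so
  distinct components are orthogonal.\<close>

lemma orth_component_inner_le:
  assumes c: "\<And>j. j \<le> d \<Longrightarrow> c j \<in> orth_space j" and k: "k \<le> d"
  shows "ball_inner (c k) (c k) \<le> ball_inner (\<Sum>j\<le>d. c j) (\<Sum>j\<le>d. c j)"
proof -
  have orth: "ball_inner (c i) (c j) = 0" if "i < j" "j \<le> d" for i j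
  proof -
    have "tdeg (c i) < j" using c[of i] that by (auto simp: orth_space_def)
    then have "ball_inner (c j) (c i) = 0" using c[of j] that by (auto simp: orth_space_def)
    then show ?thesis by (simp add: ball_inner_commute)
  qed
  have orth': "ball_inner (c i) (c j) = 0" if "i \<noteq> j" "i \<le> d" "j \<le> d" for i j
    using orth[of i j] orth[of j i] that by (auto simp: ball_inner_commute neq_iff)
  have "ball_inner (\<Sum>j\<le>d. c j) (\<Sum>j\<le>d. c j) = (\<Sum>i\<le>d. \<Sum>j\<le>d. ball_inner (c i) (c j))"
    unfolding ball_inner_sum_left
    by (subst ball_inner_commute, unfold ball_inner_sum_left) (simp add: ball_inner_commute)
  also have "\<dots> = (\<Sum>i\<le>d. ball_inner (c i) (c i))"
  proof (intro sum.cong refl)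
    fix i assume i: "i \<in> {..d}"
    then have "(\<Sum>j\<le>d. ball_inner (c i) (c j)) = (\<Sum>j\<le>d. if j = i then ball_inner (c i) (c i) else 0)"
      by (intro sum.cong) (auto simp: orth')
    then show "(\<Sum>j\<le>d. ball_inner (c i) (c j)) = ball_inner (c i) (c i)" using i by simp
  qed
  also have "\<dots> \<ge> ball_inner (c k) (c k)"
    using k by (intro member_le_sum) (auto simp: ball_inner_self_nonneg)
  finally show ?thesis .
qed

text \<open>The constant polynomial 1 is its own component of index 0 and contributes the quotient
  1. The supremum dominates it because the quotients are bounded: sup norm of the component, its L2
  norm, the L2 norm of \<open>p\<close>, and the sup norm of \<open>p\<close> are compared in
  turn.\<close>

lemma ball_gamma_ge_1:
  assumes d: "d \<ge> 1"
  shows "ball_gamma TYPE('n::finite) d \<ge> 1"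
  unfolding ball_gamma_def
proof (rule cSup_upper)
  let ?S = "{ball_norm (c k) / ball_norm p | (p :: 'n rpoly) c k.
     p \<noteq> 0 \<and> tdeg p \<le> d \<and> (\<forall>j\<le>d. c j \<in> orth_space j) \<and> p = (\<Sum>j\<le>d. c j) \<and> k \<le> d}"
  have "ball_norm (1 :: 'n rpoly) = 1"
    by (rule ball_norm_attained[of 1]) simp
  moreover have "(1 :: 'n rpoly) \<in> orth_space 0" "(0 :: 'n rpoly) \<in> orth_space j" for j
    by (auto simp: orth_space_def ball_inner_0_left)
  ultimately show "1 \<in> ?S"
    by (intro CollectI exI[of _ "1 :: 'n rpoly"] exI[of _ "\<lambda>j. if j = 0 then 1 else 0"] exI[of _ "0::nat"]) auto
  obtain C where C: "C \<ge> 0" "\<And>p::'n rpoly. tdeg p \<le> d \<Longrightarrow> (ball_norm p)\<^sup>2 \<le> C * ball_inner p p"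
    using norm_equivalence[OF d] by blast
  show "bdd_above ?S"
  proof (rule bdd_aboveI[of _ "sqrt C"], clarify)
    fix c :: "nat \<Rightarrow> 'n rpoly" and k
    let ?p = "\<Sum>j\<le>d. c j"
    assume c: "\<forall>j\<le>d. c j \<in> orth_space j" and k: "k \<le> d"
    have "tdeg (c k) \<le> d" using c k by (force simp: orth_space_def)
    from C(2)[OF this] have "(ball_norm (c k))\<^sup>2 \<le> C * ball_inner (c k) (c k)" .
    also have "\<dots> \<le> C * (ball_norm ?p)\<^sup>2"
      using orth_component_inner_le[of d c k] ball_inner_self_le[of ?p] c k C(1)
      by (intro mult_left_mono) auto
    finally have "sqrt ((ball_norm (c k))\<^sup>2) \<le> sqrt (C * (ball_norm ?p)\<^sup>2)"
      by (rule real_sqrt_le_mono)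
    then have "ball_norm (c k) \<le> sqrt C * ball_norm ?p"
      by (simp add: real_sqrt_mult ball_norm_nonneg)
    then show "ball_norm (c k) / ball_norm ?p \<le> sqrt C"
      \<comment> \<open>A zero denominator gives the quotient 0 by convention.\<close>
      using ball_norm_nonneg[of ?p] C(1) by (cases "ball_norm ?p = 0") (auto simp: field_simps)
  qed
qed

theorem theorem5:
  fixes f :: "'n::finite rpoly" and d r :: nat
  assumes "d \<ge> 1" and "tdeg f = d" and "r \<ge> d"
  shows "ub f r - ball_min f
    \<le> C_B TYPE('n) d / (2 * (real r)\<^sup>2) * (ball_max f - ball_min f)"
proof -
  have "ub f r - ball_min f \<le> (real CARD('n))\<^sup>2 * real d ^ 3 / (real r)\<^sup>2 * (ball_max f - ball_min f)"
    using assms by (intro ub_minus_min_le) auto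
  also have "\<dots> \<le> C_B TYPE('n) d / (2 * (real r)\<^sup>2) * (ball_max f - ball_min f)"
  proof (rule mult_right_mono)
    \<comment> \<open>Here gamma enters, as a factor that is at least 1.\<close>
    have "(real CARD('n))\<^sup>2 * real d ^ 3 * 1 \<le> (real CARD('n))\<^sup>2 * real d ^ 3 * ball_gamma TYPE('n) d"
      by (intro mult_left_mono ball_gamma_ge_1 assms) simp
    then show "(real CARD('n))\<^sup>2 * real d ^ 3 / (real r)\<^sup>2 \<le> C_B TYPE('n) d / (2 * (real r)\<^sup>2)"
      unfolding C_B_def by (simp add: divide_right_mono)
    show "0 \<le> ball_max f - ball_min f"
      using ball_min_le[of 0 f] ball_max_ge[of 0 f] by simp
  qed
  finally show ?thesis .
qed

end
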